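(* Let $a,b,c,d$ be nonnegative integers with $a+d\ge 1$, $b,c\ge 1$ and $\gcd(b,c,a+d)=1$, and let $m\ge 0$ be an integer. Let $\rho$ be the smallest positive root of $(1-z^b)(1-z^c)^2-4z^{a+d}$. Then there exists a positive constant $C$ (depending on $a,b,c,d$ and $m$) such that the number $[z^n]L_m(z)$ of $m$-open lambda terms of size $n$ satisfies $$[z^n]L_m(z)\sim C\,n^{-3/2}\rho^{-n}\qquad\text{as } n\to\infty .$$
   Context: Lambda terms (in De Bruijn notation) are the formal expressions generated by $M::= S^k0\ (k\ge 0)\mid \lambda M\mid (M\,M)$, where $S^k0$ is a De Bruijn index (a string of $k$ successors $S$ followed by a zero $0$, representing the index $k+1$), $\lambda M$ is an abstraction and $(M\,M)$ an application. An occurrence of $S^k0$ in a term is bound if it lies in the scope of at least $k+1$ abstractions, otherwise it is free. A term is closed if it has no free index. For an integer $m\ge0$, a term is $m$-open if prefixing it with $m$ abstractions gives a closed term. The size $|\cdot|$ is defined by $|0|=a$, $|Sn|=|n|+b$, $|\lambda M|=|M|+c$, $|M\,N|=|M|+|N|+d$. $L_m(z)=\sum_{n\ge0}L_{m,n}z^n$, where $L_{m,n}$ is the number of $m$-open lambda terms of size $n$. $[z^n]f(z)$ denotes the $n$th power series coefficient of $f$ at $0$. *)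

theory Defs
  imports
    "HOL-Analysis.Analysis"
    "HOL-Computational_Algebra.Formal_Power_Series"
    "HOL-Library.Landau_Symbols"
begin

text \<open>\<open>Idx k\<close> is the De Bruijn index \<open>S\<^sup>k0\<close>: the constructors of type \<open>nat\<close> play the roles
  of \<open>0\<close> and \<open>S\<close>.\<close>

datatype lterm = Idx nat | Lam lterm | App lterm lterm

text \<open>\<open>(k, h) \<in> index_occs M\<close> means that some occurrence of \<open>S\<^sup>k0\<close> in \<open>M\<close> lies in the scope of
  exactly \<open>h\<close> abstractions.\<close>

primrec index_occs :: "lterm \<Rightarrow> (nat \<times> nat) set" where
  "index_occs (Idx k) = {(k, 0)}"
| "index_occs (Lam M) = (\<lambda>(k, h). (k, Suc h)) ` index_occs M"
| "index_occs (App M N) = index_occs M \<union> index_occs N"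

definition bound_occ :: "nat \<times> nat \<Rightarrow> bool" where
  "bound_occ = (\<lambda>(k, h). k + 1 \<le> h)"

definition closed_term :: "lterm \<Rightarrow> bool" where
  "closed_term M \<longleftrightarrow> (\<forall>occ \<in> index_occs M. bound_occ occ)"

definition open_term :: "nat \<Rightarrow> lterm \<Rightarrow> bool" where
  "open_term m M \<longleftrightarrow> closed_term ((Lam ^^ m) M)"

primrec index_size :: "nat \<Rightarrow> nat \<Rightarrow> nat \<Rightarrow> nat" where
  "index_size a b 0 = a"
| "index_size a b (Suc k) = index_size a b k + b"

primrec term_size :: "nat \<Rightarrow> nat \<Rightarrow> nat \<Rightarrow> nat \<Rightarrow> lterm \<Rightarrow> nat" where
  "term_size a b c d (Idx k) = index_size a b k"
| "term_size a b c d (Lam M) = term_size a b c d M + c"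
| "term_size a b c d (App M N) = term_size a b c d M + term_size a b c d N + d"

definition open_term_gf :: "nat \<Rightarrow> nat \<Rightarrow> nat \<Rightarrow> nat \<Rightarrow> nat \<Rightarrow> real fps" where
  "open_term_gf a b c d m =
     Abs_fps (\<lambda>n. real (card {M. open_term m M \<and> term_size a b c d M = n}))"

text \<open>The sets counted by \<^const>\<open>open_term_gf\<close> are finite, so \<^const>\<open>card\<close> is the actual number
  of terms.\<close>

lemma index_size_eq: "index_size a b k = a + b * k"
  by (induction k) auto

lemma finite_terms_of_size:
  assumes "a + d \<ge> 1" "b \<ge> 1" "c \<ge> 1"
  shows "finite {M. term_size a b c d M = n}"
proof -
  define f where "f M = term_size a b c d M + d" for M
  have f_simps: "f (Idx k) = a + d + b * k" "f (Lam M) = f M + c" "f (App M N) = f M + f N"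
    for k M N
    by (auto simp: f_def index_size_eq)
  have pos: "f M > 0" for M
    using assms by (induction M) (auto simp: f_simps)
  have fin: "finite {M. f M < s}" for s
  proof (induction s)
    case (Suc s)
    let ?A = "{M. f M < s}"
    have "{M. f M < Suc s} \<subseteq> Idx ` {..s} \<union> Lam ` ?A \<union> case_prod App ` (?A \<times> ?A)"
    proof
      fix M assume M: "M \<in> {M. f M < Suc s}"
      show "M \<in> Idx ` {..s} \<union> Lam ` ?A \<union> case_prod App ` (?A \<times> ?A)"
      proof (cases M)
        case (Idx k)
        have "1 * k \<le> b * k" using assms(2) by (rule mult_right_mono) simp
        moreover have "a + d + b * k < Suc s" using M by (simp add: Idx f_simps)
        ultimately have "k \<le> s" by linarith
        then show ?thesis by (simp add: Idx)
      next
        case (Lam N)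
        then have "N \<in> ?A" using M assms by (simp add: f_simps)
        then show ?thesis by (simp add: Lam)
      next
        case (App N P)
        then have "(N, P) \<in> ?A \<times> ?A" using M pos[of N] pos[of P] by (simp add: f_simps)
        then have "case_prod App (N, P) \<in> case_prod App ` (?A \<times> ?A)" by (rule imageI)
        then show ?thesis by (simp add: App)
      qed
    qed
    then show ?case using Suc.IH by (elim finite_subset) auto
  qed simp
  have "{M. term_size a b c d M = n} \<subseteq> {M. f M < Suc (n + d)}"
    by (auto simp: f_def)
  then show ?thesis using fin by (rule finite_subset)
qed

end

theory Submission
  imports Defs "HOL-Complex_Analysis.Complex_Analysis" "HOL-Real_Asymp.Real_Asymp"
begin

text \<open>
  Let \<open>U\<close> be the generating function of all terms and \<open>L m\<close> that of the \<open>m\<close>-open ones. Splitting terms at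
  the root gives \<open>U = p + X\<^sup>c U + X\<^sup>d U\<^sup>2\<close> with \<open>p = X\<^sup>a / (1 - X\<^sup>b)\<close>, but for \<open>m\<close>-open terms only the
  unbounded system \<open>L m = q m + X\<^sup>c L (m+1) + X\<^sup>d (L m)\<^sup>2\<close>, where \<open>q m\<close> is the part of \<open>p\<close> coming from the
  indices below \<open>m\<close>. So \<open>U\<close> is analysed directly, and its asymptotics are carried down the system from
  \<open>m = \<infinity>\<close>.

  The function \<open>S = 1 - X\<^sup>c - 2 X\<^sup>d U\<close> satisfies \<open>S\<^sup>2 (1 - X\<^sup>b) = P\<close> with \<open>P\<close> the polynomial whose least
  positive root is \<open>\<rho>\<close>. The root is simple (\<open>discr_factor\<close>), and the gcd condition excludes every other
  root of modulus at most \<open>\<rho>\<close> (\<open>discr_root_unique\<close>). Hence \<open>S\<close> is \<open>\<surd>(1 - X / \<rho>)\<close> times a function \<open>G\<close>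
  that is analytic in a disc of radius greater than \<open>\<rho>\<close> and does not vanish at \<open>\<rho>\<close> (\<open>sqrt_factor\<close>).
  The coefficients of the square root are binomial coefficients of order \<open>n\<^bsup>-3/2\<^esup> \<rho>\<^bsup>-n\<^esup>\<close>, and
  multiplication by \<open>G\<close> only changes the constant by the factor \<open>G(\<rho>)\<close>, which proves the claim for \<open>U\<close>
  (\<open>U_asymp\<close>).

  A term that is not \<open>m\<close>-open has an occurrence of an index that points above \<open>m\<close> further abstractions.
  Following the path to this occurrence bounds the number of such terms by the coefficients of \<open>X\<^bsup>bm\<^esup> W\<close>
  with \<open>W = p / (1 - 2 X\<^sup>d U - X\<^bsup>b+c\<^esup>)\<close> (\<open>non_open_le\<close>). As \<open>2 \<rho>\<^sup>d U(\<rho>) = 1 - \<rho>\<^sup>c\<close>, the denominator is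
  positive at \<open>\<rho>\<close>, so the coefficients of \<open>W\<close> have at most the order of those of \<open>U\<close> (\<open>renewal_bound\<close>,
  \<open>deep_gf_bound\<close>). In units of \<open>n\<^bsup>-3/2\<^esup> \<rho>\<^bsup>-n\<^esup>\<close> the coefficients of \<open>L M\<close> are therefore eventually
  within \<open>O(\<rho>\<^bsup>bM\<^esup>)\<close> of the constant for \<open>U\<close> (\<open>near_L_large\<close>).

  In such units, squaring a power series multiplies an approximate limit and its error by twice the value
  of the series at \<open>\<rho>\<close> (\<open>near_square\<close>). The equation for \<open>L m\<close> thus turns an approximate limit of
  \<open>L (m+1)\<close> into one of \<open>L m\<close>, with both the limit and the error multiplied by
  \<open>\<rho>\<^sup>c / (1 - 2 \<rho>\<^sup>d L m (\<rho>)) \<in> (0, 1]\<close> (\<open>near_L_descent\<close>). Descending from \<open>M\<close> to \<open>m\<close> leaves the relative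
  error unchanged and the absolute error at most \<open>O(\<rho>\<^bsup>bM\<^esup>)\<close>; as \<open>M\<close> grows, this gives existence and
  positivity of the limit for \<open>L m\<close> (\<open>L_asymp\<close>).
\<close>

section \<open>Generating functions of terms\<close>

definition index_gf :: "nat \<Rightarrow> nat \<Rightarrow> nat set \<Rightarrow> real fps" where
  "index_gf a b I = Abs_fps (\<lambda>n. real (card {k \<in> I. a + b * k = n}))"

definition term_gf :: "nat \<Rightarrow> nat \<Rightarrow> nat \<Rightarrow> nat \<Rightarrow> lterm set \<Rightarrow> real fps" where
  "term_gf a b c d A = Abs_fps (\<lambda>n. real (card {M \<in> A. term_size a b c d M = n}))"

lemma open_term_gf_eq: "open_term_gf a b c d m = term_gf a b c d {M. open_term m M}"
  by (simp add: open_term_gf_def term_gf_def)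

lemma open_term_iff: "open_term m M \<longleftrightarrow> (\<forall>(k, h) \<in> index_occs M. k < h + m)"
proof -
  have "index_occs ((Lam ^^ m) M) = (\<lambda>(k, h). (k, h + m)) ` index_occs M"
    by (induction m) (force simp: image_iff)+
  then show ?thesis
    by (auto simp: open_term_def closed_term_def bound_occ_def)
qed

lemma open_term_simps:
  "open_term m (Idx k) \<longleftrightarrow> k < m"
  "open_term m (Lam M) \<longleftrightarrow> open_term (Suc m) M"
  "open_term m (App M N) \<longleftrightarrow> open_term m M \<and> open_term m N"
  by (auto simp: open_term_iff)

lemma open_terms_decomp:
  "{M. open_term m M} = Idx ` {..<m} \<union> Lam ` {M. open_term (Suc m) M} \<union>
     case_prod App ` ({M. open_term m M} \<times> {M. open_term m M})" (is "?L = ?R")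
proof -
  have "M \<in> ?L \<longleftrightarrow> M \<in> ?R" for M
    by (cases M) (auto simp: open_term_simps)
  then show ?thesis by blast
qed

lemma all_terms_decomp:
  "(UNIV :: lterm set) = Idx ` UNIV \<union> Lam ` UNIV \<union> case_prod App ` (UNIV \<times> UNIV)" (is "?L = ?R")
proof -
  have "M \<in> ?R" for M
    by (cases M) auto
  then show ?thesis by blast
qed

lemma term_gf_nonneg [simp]: "fps_nth (term_gf a b c d A) n \<ge> 0"
  by (simp add: term_gf_def)

lemma index_gf_le_1:
  assumes "b \<ge> 1"
  shows "fps_nth (index_gf a b I) n \<le> 1"
proof -
  have "{k \<in> I. a + b * k = n} \<subseteq> {(n - a) div b}"
    using assms by auto
  then have "card {k \<in> I. a + b * k = n} \<le> 1"
    by (metis card_mono finite.emptyI finite.insertI card.empty card_insert_disjoint empty_iff One_nat_def)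
  then show ?thesis by (simp add: index_gf_def)
qed

lemma index_gf_nonneg [simp]: "fps_nth (index_gf a b I) n \<ge> 0"
  by (simp add: index_gf_def)

lemma finite_index: "b \<ge> 1 \<Longrightarrow> finite {k \<in> I. a + b * k = (n::nat)}"
  by (rule finite_subset[of _ "{(n - a) div b}"]) auto

lemma index_gf_Un:
  assumes "b \<ge> 1" "I \<inter> J = {}"
  shows "index_gf a b (I \<union> J) = index_gf a b I + index_gf a b J"
proof -
  have "card {k \<in> I \<union> J. a + b * k = n} = card {k \<in> I. a + b * k = n} + card {k \<in> J. a + b * k = n}" for n
  proof -
    have "{k \<in> I \<union> J. a + b * k = n} = {k \<in> I. a + b * k = n} \<union> {k \<in> J. a + b * k = n}" by auto
    then show ?thesis
      using assms finite_index[OF assms(1)] by (subst card_Un_disjoint[symmetric]) auto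
  qed
  then show ?thesis by (simp add: fps_eq_iff index_gf_def)
qed

lemma index_gf_atLeast:
  assumes "b \<ge> 1"
  shows "index_gf a b {m..} = fps_X ^ (b * m) * index_gf a b UNIV"
proof (rule fps_ext)
  fix n
  have "card {k \<in> {m..}. a + b * k = n} = (if n < b * m then 0 else card {k. a + b * k = n - b * m})"
  proof (cases "n < b * m")
    case True
    have "a + b * k \<noteq> n" if "k \<ge> m" for k
    proof -
      have "b * m \<le> b * k" using that by simp
      then show ?thesis using True by linarith
    qed
    then have empty: "{k \<in> {m..}. a + b * k = n} = {}" by auto
    show ?thesis using True by (subst empty) simp
  next
    case False
    have "bij_betw (\<lambda>k. k + m) {k. a + b * k = n - b * m} {k \<in> {m..}. a + b * k = n}"
    proof (rule bij_betwI[where g = "\<lambda>k. k - m"])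
      show "(\<lambda>k. k + m) \<in> {k. a + b * k = n - b * m} \<rightarrow> {k \<in> {m..}. a + b * k = n}"
        using False by (auto simp: algebra_simps)
      show "(\<lambda>k. k - m) \<in> {k \<in> {m..}. a + b * k = n} \<rightarrow> {k. a + b * k = n - b * m}"
        using False by (auto simp: diff_mult_distrib2)
    qed auto
    then show ?thesis using False by (simp add: bij_betw_same_card)
  qed
  then show "index_gf a b {m..} $ n = (fps_X ^ (b * m) * index_gf a b UNIV) $ n"
    by (simp add: index_gf_def fps_X_power_mult_nth)
qed

lemma index_gf_UNIV:
  assumes "b \<ge> 1"
  shows "index_gf a b UNIV * (1 - fps_X ^ b) = fps_X ^ a"
proof -
  have "index_gf a b UNIV = index_gf a b {0} + index_gf a b {1..}"
  proof -
    have "{0} \<union> {1..} = (UNIV :: nat set)" by auto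
    then show ?thesis using index_gf_Un[OF assms, of "{0}" "{1..}" a] by simp
  qed
  also have "index_gf a b {0} = fps_X ^ a"
    by (rule fps_ext) (auto simp: index_gf_def conj_commute cong: conj_cong)
  also have "index_gf a b {1..} = fps_X ^ b * index_gf a b UNIV"
    using index_gf_atLeast[OF assms, of a 1] by simp
  finally show ?thesis by (simp add: algebra_simps)
qed

text \<open>Splitting a term at its root: the shape of the functional equation common to \<open>m\<close>-open terms
  (with \<open>B\<close> the \<open>(m+1)\<close>-open ones) and to all terms.\<close>

lemma term_gf_decomp:
  assumes size: "a + d \<ge> 1" "b \<ge> 1" "c \<ge> 1"
    and A: "A = Idx ` I \<union> Lam ` B \<union> case_prod App ` (A \<times> A)"
  shows "term_gf a b c d A =
    index_gf a b I + fps_X ^ c * term_gf a b c d B + fps_X ^ d * (term_gf a b c d A)\<^sup>2"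
proof (rule fps_ext)
  fix n
  let ?s = "term_size a b c d"
  let ?lv = "\<lambda>S n. {M \<in> S. ?s M = n}"
  have fin: "finite (?lv S n)" for S n
    using finite_terms_of_size[OF size, of n] by (rule finite_subset[rotated]) auto
  have nth_gf: "term_gf a b c d S $ n = real (card (?lv S n))" for S n
    by (simp add: term_gf_def)
  have nth_sq: "(term_gf a b c d A)\<^sup>2 $ n =
      (\<Sum>i=0..n. real (card (?lv A i)) * real (card (?lv A (n - i))))" for n
    by (simp add: nth_gf power2_eq_square fps_mult_nth)
  let ?i = "{k \<in> I. a + b * k = n}" and ?l = "{M \<in> B. ?s M + c = n}"
    and ?p = "{q \<in> A \<times> A. ?s (fst q) + ?s (snd q) + d = n}"
  have finl: "finite ?l"
    using fin[of B "n - c"] by (rule finite_subset[rotated]) auto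
  have p_Un: "?p = (if n < d then {} else \<Union>i\<in>{0..n - d}. ?lv A i \<times> ?lv A (n - d - i))"
    by (auto simp: le_diff_conv2)
  have finp: "finite ?p"
    unfolding p_Un using fin by auto
  have "?lv A n = Idx ` ?i \<union> (Lam ` ?l \<union> case_prod App ` ?p)"
  proof (rule set_eqI)
    fix M show "M \<in> ?lv A n \<longleftrightarrow> M \<in> Idx ` ?i \<union> (Lam ` ?l \<union> case_prod App ` ?p)"
    proof (cases M)
      case (Idx k)
      have "M \<in> A \<longleftrightarrow> k \<in> I" by (subst A) (auto simp: Idx)
      then show ?thesis by (auto simp: Idx index_size_eq)
    next
      case (Lam N)
      have "M \<in> A \<longleftrightarrow> N \<in> B" by (subst A) (auto simp: Lam)
      then show ?thesis by (auto simp: Lam)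
    next
      case (App N P)
      have "M \<in> A \<longleftrightarrow> N \<in> A \<and> P \<in> A" by (subst A) (auto simp: App)
      then show ?thesis by (force simp: App)
    qed
  qed
  then have "card (?lv A n) = card (Idx ` ?i) + (card (Lam ` ?l) + card (case_prod App ` ?p))"
    using finl finp finite_index[OF size(2), of I a n] by (simp, subst card_Un_disjoint; auto)+
  moreover have "card (Idx ` ?i) = card ?i"
    by (rule card_image) (auto simp: inj_on_def)
  moreover have "card (Lam ` ?l) = card ?l"
    by (rule card_image) (auto simp: inj_on_def)
  moreover have "card (case_prod App ` ?p) = card ?p"
    by (rule card_image) (auto simp: inj_on_def)
  moreover have "card ?l = (if n < c then 0 else card (?lv B (n - c)))"
    by (auto intro!: arg_cong[where f = card])
  moreover have "card ?p = (if n < d then 0 else \<Sum>i=0..n - d. card (?lv A i) * card (?lv A (n - d - i)))"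
  proof (cases "n < d")
    case False
    then have "card ?p = card (\<Union>i\<in>{0..n - d}. ?lv A i \<times> ?lv A (n - d - i))"
      by (subst p_Un) simp
    also have "\<dots> = (\<Sum>i=0..n - d. card (?lv A i \<times> ?lv A (n - d - i)))"
      using fin by (intro card_UN_disjoint) auto
    finally show ?thesis using False by (simp add: card_cartesian_product)
  qed (simp add: p_Un)
  ultimately show "term_gf a b c d A $ n =
     (index_gf a b I + fps_X ^ c * term_gf a b c d B + fps_X ^ d * (term_gf a b c d A)\<^sup>2) $ n"
    by (simp add: nth_gf nth_sq index_gf_def fps_X_power_mult_nth)
qed

lemma term_gf_mono:
  assumes "a + d \<ge> 1" "b \<ge> 1" "c \<ge> 1" "A \<subseteq> B"
  shows "fps_nth (term_gf a b c d A) n \<le> fps_nth (term_gf a b c d B) n"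
proof -
  have "card {M \<in> A. term_size a b c d M = n} \<le> card {M \<in> B. term_size a b c d M = n}"
    using assms finite_subset[OF _ finite_terms_of_size[OF assms(1-3), of n]]
    by (intro card_mono) auto
  then show ?thesis by (simp add: term_gf_def)
qed


section \<open>Convolution with sequences of order \<open>n\<^bsup>-3/2\<^esup>\<close>\<close>

text \<open>All asymptotics are measured against this sequence. The shift by one keeps it positive at \<open>0\<close>, so
  that quotients by it and bounds \<open>f n \<le> B * wt n\<close> for all \<open>n\<close> make sense.\<close>

definition wt :: "nat \<Rightarrow> real" where
  "wt n = real (Suc n) powr (-3/2)"

lemma wt_pos [simp]: "wt n > 0" and wt_nonneg [simp]: "wt n \<ge> 0" and wt_neq_0 [simp]: "wt n \<noteq> 0"
  by (simp_all add: wt_def)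

lemma summable_wt: "summable wt"
proof -
  have "summable (\<lambda>n. real n powr (-3/2))"
    by (subst summable_real_powr_iff) auto
  then show ?thesis
    unfolding wt_def by (subst summable_Suc_iff[where f = "\<lambda>n. real n powr (-3/2)"])
qed

lemma wt_shift_ratio: "(\<lambda>n. wt (n - k) / wt n) \<longlonglongrightarrow> 1"
proof (rule LIMSEQ_offset[where k = k])
  show "(\<lambda>n. wt (n + k - k) / wt (n + k)) \<longlonglongrightarrow> 1"
    unfolding wt_def add_diff_cancel_right' of_nat_Suc of_nat_add by real_asymp
qed

lemma wt_shift_le:
  assumes "k \<le> n"
  shows "wt (n - k) \<le> (real k + 1) powr (3/2) * wt n"
proof -
  have "real (Suc n) \<le> (real k + 1) * real (Suc (n - k))"
    using assms by (auto simp: of_nat_diff algebra_simps intro: mult_left_mono)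
  then have "((real k + 1) * real (Suc (n - k))) powr (-3/2) \<le> wt n"
    unfolding wt_def by (intro powr_mono2') auto
  moreover have "((real k + 1) * real (Suc (n - k))) powr (-3/2) = (real k + 1) powr (-3/2) * wt (n - k)"
    unfolding wt_def by (rule powr_mult)
  moreover have "(real k + 1) powr (3/2) * (real k + 1) powr (-3/2) = 1"
    by (simp flip: powr_add)
  ultimately have le: "(real k + 1) powr (-3/2) * wt (n - k) \<le> wt n"
    and inv: "(real k + 1) powr (3/2) * (real k + 1) powr (-3/2) = 1"
    by simp_all
  have "wt (n - k) = (real k + 1) powr (3/2) * ((real k + 1) powr (-3/2) * wt (n - k))"
    using inv by (simp only: mult.assoc[symmetric])
  also have "\<dots> \<le> (real k + 1) powr (3/2) * wt n"
    using le by (rule mult_left_mono) simp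
  finally show ?thesis .
qed

text \<open>Here \<open>3\<close> is a convenient bound for \<open>2\<^bsup>3/2\<^esup>\<close>.\<close>

lemma wt_half_le:
  assumes "2 * k \<le> n"
  shows "wt (n - k) \<le> 3 * wt n"
proof -
  have "real (Suc n) \<le> 2 * real (Suc (n - k))"
    using assms by (auto simp: of_nat_diff)
  then have "(2 * real (Suc (n - k))) powr (-3/2) \<le> wt n"
    unfolding wt_def by (intro powr_mono2') auto
  moreover have "(2 * real (Suc (n - k))) powr (-3/2) = 2 powr (-3/2) * wt (n - k)"
    unfolding wt_def by (rule powr_mult)
  moreover have "(1/3) * wt (n - k) \<le> 2 powr (-3/2) * wt (n - k)"
  proof (rule mult_right_mono)
    have "(2 powr (-3/2))\<^sup>2 = (2::real) powr (-3)"
      by (simp add: powr_power)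
    also have "\<dots> = 1 / 8"
      by (simp add: powr_minus powr_numeral)
    finally have "(1/3::real)\<^sup>2 \<le> (2 powr (-3/2))\<^sup>2" by (simp add: power2_eq_square)
    then show "(1/3::real) \<le> 2 powr (-3/2)"
      by (rule power2_le_imp_le) simp
  qed simp
  ultimately have "(1/3) * wt (n - k) \<le> wt n" by linarith
  then show ?thesis by simp
qed

text \<open>In a convolution only the terms with one small index matter. Up to \<open>k = n/2\<close> the quotient
  \<open>wt (n - k) / wt n\<close> is bounded and tends to \<open>1\<close>, so Tannery's theorem applies. The set \<open>A n\<close> leaves open
  whether the middle term is included, because splitting a convolution into two halves assigns it to one
  of them.\<close>

lemma half_sum_tendsto:
  fixes f :: "nat \<Rightarrow> real"
  assumes "summable f" and nonneg: "\<And>n. f n \<ge> 0"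
    and A: "\<And>n. {k. 2 * k < n} \<subseteq> A n" "\<And>n. A n \<subseteq> {k. 2 * k \<le> n}"
  shows "(\<lambda>n. (\<Sum>k\<in>A n. f k * wt (n - k)) / wt n) \<longlonglongrightarrow> suminf f"
proof -
  define t where "t k n = (if k \<in> A n then f k * (wt (n - k) / wt n) else 0)" for k n
  have fin: "finite (A n)" for n
    by (rule finite_subset[OF A(2)]) (auto intro: finite_subset[of _ "{..n}"])
  have "eventually (\<lambda>n. summable (\<lambda>k. norm (t k n))) sequentially \<and> summable (\<lambda>k. norm (f k)) \<and>
     (\<lambda>n. suminf (\<lambda>k. t k n)) \<longlonglongrightarrow> suminf f"
  proof (rule tannerys_theorem[where M = "\<lambda>k. 3 * f k"])
    fix k
    have "eventually (\<lambda>n. f k * (wt (n - k) / wt n) = t k n) sequentially"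
      using eventually_gt_at_top[of "2 * k"]
      by eventually_elim (use A in \<open>auto simp: t_def\<close>)
    moreover have "(\<lambda>n. f k * (wt (n - k) / wt n)) \<longlonglongrightarrow> f k * 1"
      by (intro tendsto_intros wt_shift_ratio)
    ultimately show "(\<lambda>n. t k n) \<longlonglongrightarrow> f k"
      by (simp add: filterlim_cong)
  next
    have "norm (t k n) \<le> 3 * f k" for k n
    proof (cases "k \<in> A n")
      case True
      then have "wt (n - k) / wt n \<le> 3"
        using A wt_half_le[of k n] by (auto simp: field_simps)
      then have "f k * (wt (n - k) / wt n) \<le> f k * 3"
        by (intro mult_left_mono nonneg)
      then show ?thesis using True nonneg[of k] by (simp add: t_def)
    qed (use nonneg[of k] in \<open>simp add: t_def\<close>)
    then show "eventually (\<lambda>(k, n). norm (t k n) \<le> 3 * f k) (at_top \<times>\<^sub>F sequentially)"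
      by (intro always_eventually) auto
  qed (use assms in \<open>auto intro: summable_mult\<close>)
  moreover have "suminf (\<lambda>k. t k n) = (\<Sum>k\<in>A n. f k * wt (n - k)) / wt n" for n
  proof -
    have "suminf (\<lambda>k. t k n) = (\<Sum>k\<in>A n. t k n)"
      by (rule suminf_finite[OF fin]) (simp add: t_def)
    then show ?thesis by (simp add: t_def sum_divide_distrib)
  qed
  ultimately show ?thesis by simp
qed

text \<open>Here the summation runs over all \<open>k \<le> n\<close>; the polynomial growth of \<open>wt (n - k) / wt n\<close> in \<open>k\<close> is
  absorbed by the decay of \<open>f\<close>.\<close>

lemma convolution_tendsto:
  fixes f s :: "nat \<Rightarrow> complex"
  assumes summ: "summable (\<lambda>k. (real k + 1) powr (3/2) * norm (f k))"
    and lim: "(\<lambda>n. s n / of_real (wt n)) \<longlonglongrightarrow> l"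
  shows "(\<lambda>n. (\<Sum>k\<le>n. f k * s (n - k)) / of_real (wt n)) \<longlonglongrightarrow> suminf f * l"
proof -
  obtain B where B: "\<And>n. norm (s n / of_real (wt n)) \<le> B"
    using convergent_imp_Bseq[OF convergentI[OF lim]] unfolding Bseq_def by blast
  have "B \<ge> 0" using B[of 0] norm_ge_zero by (rule order_trans[rotated])
  define t where "t k n =
    (if k \<le> n then f k * (s (n - k) / of_real (wt (n - k)) * of_real (wt (n - k) / wt n)) else 0)" for k n
  have "eventually (\<lambda>n. summable (\<lambda>k. norm (t k n))) sequentially \<and> summable (\<lambda>k. norm (f k * l)) \<and>
     (\<lambda>n. suminf (\<lambda>k. t k n)) \<longlonglongrightarrow> suminf (\<lambda>k. f k * l)"
  proof (rule tannerys_theorem[where M = "\<lambda>k. B * ((real k + 1) powr (3/2) * norm (f k))"])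
    fix k
    have sh: "(\<lambda>n. s (n - k) / of_real (wt (n - k))) \<longlonglongrightarrow> l"
      by (rule LIMSEQ_offset[where k = k]) (simp add: lim)
    have "(\<lambda>n. f k * (s (n - k) / of_real (wt (n - k)) * of_real (wt (n - k) / wt n))) \<longlonglongrightarrow>
        f k * (l * of_real 1)"
      by (intro tendsto_intros sh wt_shift_ratio)
    moreover have "eventually (\<lambda>n. f k * (s (n - k) / of_real (wt (n - k)) * of_real (wt (n - k) / wt n)) = t k n) sequentially"
      using eventually_ge_at_top[of k] by eventually_elim (simp add: t_def)
    ultimately show "(\<lambda>n. t k n) \<longlonglongrightarrow> f k * l"
      by (simp add: filterlim_cong)
  next
    have "norm (t k n) \<le> B * ((real k + 1) powr (3/2) * norm (f k))" for k n
    proof (cases "k \<le> n")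
      case True
      have "wt (n - k) / wt n \<le> (real k + 1) powr (3/2)"
        using wt_shift_le[OF True] by (simp add: field_simps)
      then have "norm (s (n - k) / of_real (wt (n - k))) * norm (of_real (wt (n - k) / wt n) :: complex)
          \<le> B * (real k + 1) powr (3/2)"
        using \<open>B \<ge> 0\<close> by (intro mult_mono B) (auto simp: norm_divide)
      then have "norm (f k) * (norm (s (n - k) / of_real (wt (n - k))) * norm (of_real (wt (n - k) / wt n) :: complex))
          \<le> norm (f k) * (B * (real k + 1) powr (3/2))"
        by (rule mult_left_mono) simp
      then show ?thesis using True by (simp only: t_def if_True norm_mult mult_ac)
    qed (use \<open>B \<ge> 0\<close> in \<open>simp add: t_def\<close>)
    then show "eventually (\<lambda>(k, n). norm (t k n) \<le> B * ((real k + 1) powr (3/2) * norm (f k))) (at_top \<times>\<^sub>F sequentially)"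
      by (intro always_eventually) auto
  qed (use summ in \<open>auto intro: summable_mult\<close>)
  moreover have "suminf (\<lambda>k. t k n) = (\<Sum>k\<le>n. f k * s (n - k)) / of_real (wt n)" for n
  proof -
    have "suminf (\<lambda>k. t k n) = (\<Sum>k\<le>n. t k n)"
      by (rule suminf_finite) (auto simp: t_def)
    also have "\<dots> = (\<Sum>k\<le>n. f k * s (n - k) / of_real (wt n))"
      by (intro sum.cong) (auto simp: t_def)
    finally show ?thesis by (simp add: sum_divide_distrib)
  qed
  moreover have "suminf (\<lambda>k. f k * l) = suminf f * l"
  proof -
    have "summable (\<lambda>k. norm (f k))"
    proof (rule summable_comparison_test_ev[OF _ summ])
      have "norm (f k) \<le> (real k + 1) powr (3/2) * norm (f k)" for k
        using mult_right_mono[of 1 "(real k + 1) powr (3/2)" "norm (f k)"] by (simp add: ge_one_powr_ge_zero)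
      then show "\<forall>\<^sub>F n in sequentially. norm (norm (f n)) \<le> (real n + 1) powr (3/2) * norm (f n)"
        by simp
    qed
    then show ?thesis by (rule suminf_mult2[symmetric, OF summable_norm_cancel])
  qed
  ultimately show ?thesis by simp
qed

lemma convolution_split:
  fixes f g :: "nat \<Rightarrow> real"
  shows "(\<Sum>k=0..n. f k * g (n - k)) =
    (\<Sum>k\<in>{k. 2 * k \<le> n}. f k * g (n - k)) + (\<Sum>k\<in>{k. 2 * k < n}. g k * f (n - k))"
proof -
  have fin: "finite {k. 2 * k \<le> n}" "finite {k. k \<le> n \<and> 2 * k > n}"
    by (auto intro: finite_subset[of _ "{..n}"])
  have "{0..n} = {k. 2 * k \<le> n} \<union> {k. k \<le> n \<and> 2 * k > n}" by auto
  then have "(\<Sum>k=0..n. f k * g (n - k)) =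
      (\<Sum>k\<in>{k. 2 * k \<le> n}. f k * g (n - k)) + (\<Sum>k\<in>{k. k \<le> n \<and> 2 * k > n}. f k * g (n - k))"
    using fin by (simp add: sum.union_disjoint disjoint_iff)
  also have "(\<Sum>k\<in>{k. k \<le> n \<and> 2 * k > n}. f k * g (n - k)) = (\<Sum>k\<in>{k. 2 * k < n}. g k * f (n - k))"
    by (rule sum.reindex_bij_witness[of _ "\<lambda>k. n - k" "\<lambda>k. n - k"]) auto
  finally show ?thesis .
qed

text \<open>This says \<open>limsup \<bar>f n / wt n - l\<bar> \<le> e\<close>: the sequence has the limit \<open>l\<close> relative to \<open>wt\<close> up to an
  asymptotic error \<open>e\<close>.\<close>

definition near :: "(nat \<Rightarrow> real) \<Rightarrow> real \<Rightarrow> real \<Rightarrow> bool" where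
  "near f l e \<longleftrightarrow> (\<forall>e'>e. \<forall>\<^sub>F n in sequentially. \<bar>f n - l * wt n\<bar> \<le> e' * wt n)"

lemma near_add:
  assumes "near f l e" "near g l' e'"
  shows "near (\<lambda>n. f n + g n) (l + l') (e + e')"
  unfolding near_def
proof (intro allI impI)
  fix x assume x: "x > e + e'"
  define h where "h = (x - e - e') / 2"
  have "\<forall>\<^sub>F n in sequentially. \<bar>f n - l * wt n\<bar> \<le> (e + h) * wt n"
    and "\<forall>\<^sub>F n in sequentially. \<bar>g n - l' * wt n\<bar> \<le> (e' + h) * wt n"
    using assms x unfolding near_def by (simp_all add: h_def)
  then show "\<forall>\<^sub>F n in sequentially. \<bar>f n + g n - (l + l') * wt n\<bar> \<le> x * wt n"
  proof eventually_elim
    case (elim n)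
    have "\<bar>f n + g n - (l + l') * wt n\<bar> = \<bar>(f n - l * wt n) + (g n - l' * wt n)\<bar>"
      by (simp add: algebra_simps)
    also have "\<dots> \<le> (e + h) * wt n + (e' + h) * wt n"
      using elim by linarith
    also have "\<dots> = x * wt n" unfolding h_def by (simp add: field_simps)
    finally show ?case .
  qed
qed

text \<open>Since \<open>n - k \<ge> n/2\<close> on \<open>A n\<close>, every \<open>g (n - k)\<close> occurring in the sum is already in its asymptotic
  regime once \<open>n\<close> is large.\<close>

lemma near_half_sum:
  assumes f: "summable f" "\<And>n. f n \<ge> 0"
    and A: "\<And>n. {k. 2 * k < n} \<subseteq> A n" "\<And>n. A n \<subseteq> {k. 2 * k \<le> n}"
    and g: "near g l e"
  shows "near (\<lambda>n. \<Sum>k\<in>A n. f k * g (n - k)) (suminf f * l) (suminf f * e)"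
  unfolding near_def
proof (intro allI impI)
  fix x assume x: "x > suminf f * e"
  define F where "F = suminf f"
  have F: "F \<ge> 0" using f by (simp add: F_def suminf_nonneg)
  \<comment> \<open>The slack \<open>h\<close> is chosen with \<open>F * (e + h) < x\<close>; dividing by \<open>F + 1\<close> covers \<open>F = 0\<close>.\<close>
  define h where "h = (x - F * e) / (F + 1)"
  have h: "h > 0" using F x by (simp add: h_def F_def)
  define H where "H n = (\<Sum>k\<in>A n. f k * wt (n - k)) / wt n" for n
  have H: "H \<longlonglongrightarrow> F"
    unfolding H_def F_def using half_sum_tendsto[OF f A] by simp
  have "(\<lambda>n. (e + h) * H n + \<bar>l\<bar> * \<bar>H n - F\<bar>) \<longlonglongrightarrow> (e + h) * F + \<bar>l\<bar> * \<bar>F - F\<bar>"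
    by (intro tendsto_intros H)
  moreover have "(e + h) * F + \<bar>l\<bar> * \<bar>F - F\<bar> < x"
  proof -
    have "h * F < h * (F + 1)" using h by simp
    also have "\<dots> = x - F * e" using F by (simp add: h_def)
    finally show ?thesis by (simp add: algebra_simps)
  qed
  ultimately have ev: "\<forall>\<^sub>F n in sequentially. (e + h) * H n + \<bar>l\<bar> * \<bar>H n - F\<bar> < x"
    by (rule order_tendstoD)
  have "\<forall>\<^sub>F n in sequentially. \<bar>g n - l * wt n\<bar> \<le> (e + h) * wt n"
    using g h unfolding near_def by simp
  then obtain N where N: "\<And>n. n \<ge> N \<Longrightarrow> \<bar>g n - l * wt n\<bar> \<le> (e + h) * wt n"
    by (auto simp: eventually_at_top_linorder)
  show "\<forall>\<^sub>F n in sequentially. \<bar>(\<Sum>k\<in>A n. f k * g (n - k)) - suminf f * l * wt n\<bar> \<le> x * wt n"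
    using ev eventually_ge_at_top[of "2 * N"]
  proof eventually_elim
    case (elim n)
    have "(\<Sum>k\<in>A n. f k * g (n - k)) - F * l * wt n =
        (\<Sum>k\<in>A n. f k * (g (n - k) - l * wt (n - k))) + l * (H n - F) * wt n"
    proof -
      have "(\<Sum>k\<in>A n. f k * (g (n - k) - l * wt (n - k))) =
          (\<Sum>k\<in>A n. f k * g (n - k)) - l * (\<Sum>k\<in>A n. f k * wt (n - k))"
        by (simp add: algebra_simps sum_subtractf sum_distrib_left)
      also have "(\<Sum>k\<in>A n. f k * wt (n - k)) = H n * wt n"
        by (simp add: H_def)
      finally show ?thesis by (simp add: algebra_simps)
    qed
    also have "\<bar>\<dots>\<bar> \<le> (\<Sum>k\<in>A n. \<bar>f k * (g (n - k) - l * wt (n - k))\<bar>) + \<bar>l * (H n - F) * wt n\<bar>"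
      by (intro order_trans[OF abs_triangle_ineq] add_right_mono sum_abs)
    also have "(\<Sum>k\<in>A n. \<bar>f k * (g (n - k) - l * wt (n - k))\<bar>) \<le> (\<Sum>k\<in>A n. f k * ((e + h) * wt (n - k)))"
    proof (rule sum_mono)
      fix k assume "k \<in> A n"
      then have "n - k \<ge> N" using A(2)[of n] elim by auto
      then show "\<bar>f k * (g (n - k) - l * wt (n - k))\<bar> \<le> f k * ((e + h) * wt (n - k))"
        using f(2)[of k] N by (auto simp: abs_mult intro: mult_left_mono)
    qed
    also have "(\<Sum>k\<in>A n. f k * ((e + h) * wt (n - k))) = (e + h) * (\<Sum>k\<in>A n. f k * wt (n - k))"
      by (simp add: sum_distrib_left mult_ac)
    also have "(\<Sum>k\<in>A n. f k * wt (n - k)) = H n * wt n"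
      by (simp add: H_def)
    also have "(e + h) * (H n * wt n) + \<bar>l * (H n - F) * wt n\<bar> =
        ((e + h) * H n + \<bar>l\<bar> * \<bar>H n - F\<bar>) * wt n"
      by (simp add: abs_mult distrib_right mult.assoc)
    also have "\<dots> \<le> x * wt n"
      using elim by (intro mult_right_mono) auto
    finally show ?case by (simp add: F_def)
  qed
qed

text \<open>A shift is the convolution with a unit vector.\<close>

lemma near_shift:
  assumes "near f l e"
  shows "near (\<lambda>n. if n < k then 0 else f (n - k)) l e"
proof -
  define d where "d i = (if i = k then 1 else 0 :: real)" for i
  have d: "d sums 1"
    using sums_single[of k "\<lambda>_. 1"] unfolding d_def .
  have "near (\<lambda>n. \<Sum>i\<in>{i. 2 * i \<le> n}. d i * f (n - i)) (suminf d * l) (suminf d * e)"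
    using d by (intro near_half_sum assms) (auto simp: d_def sums_iff)
  then have *: "near (\<lambda>n. \<Sum>i\<in>{i. 2 * i \<le> n}. d i * f (n - i)) l e"
    using d by (simp add: sums_iff)
  show ?thesis
    unfolding near_def
  proof (intro allI impI)
    fix x assume "x > e"
    then have "\<forall>\<^sub>F n in sequentially. \<bar>(\<Sum>i\<in>{i. 2 * i \<le> n}. d i * f (n - i)) - l * wt n\<bar> \<le> x * wt n"
      using * unfolding near_def by blast
    then show "\<forall>\<^sub>F n in sequentially. \<bar>(if n < k then 0 else f (n - k)) - l * wt n\<bar> \<le> x * wt n"
      using eventually_ge_at_top[of "2 * k"]
    proof eventually_elim
      case (elim n)
      have "(\<Sum>i\<in>{i. 2 * i \<le> n}. d i * f (n - i)) = (\<Sum>i\<in>{k}. d i * f (n - i))"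
        using elim by (intro sum.mono_neutral_right) (auto simp: d_def intro: finite_subset[of _ "{..n}"])
      then show ?case using elim by (auto simp: d_def)
    qed
  qed
qed

lemma near_cmult:
  assumes "near f l e" "c \<ge> 0"
  shows "near (\<lambda>n. c * f n) (c * l) (c * e)"
proof (cases "c = 0")
  case True
  then show ?thesis by (auto simp: near_def)
next
  case False
  then have c: "c > 0" using assms by simp
  show ?thesis unfolding near_def
  proof (intro allI impI)
    fix x assume "x > c * e"
    then have "x / c > e" using c by (simp add: field_simps)
    then have "\<forall>\<^sub>F n in sequentially. \<bar>f n - l * wt n\<bar> \<le> x / c * wt n"
      using assms unfolding near_def by blast
    then show "\<forall>\<^sub>F n in sequentially. \<bar>c * f n - c * l * wt n\<bar> \<le> x * wt n"
    proof eventually_elim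
      case (elim n)
      have "\<bar>c * f n - c * l * wt n\<bar> = c * \<bar>f n - l * wt n\<bar>"
        using c by (simp add: abs_mult mult.assoc flip: right_diff_distrib)
      also have "\<dots> \<le> c * (x / c * wt n)" using elim c by (intro mult_left_mono) auto
      finally show ?case using c by simp
    qed
  qed
qed

lemma near_square:
  assumes f: "summable f" "\<And>n. f n \<ge> 0" and n: "near f l e"
  shows "near (\<lambda>n. \<Sum>k=0..n. f k * f (n - k)) (2 * suminf f * l) (2 * suminf f * e)"
proof -
  have "near (\<lambda>n. (\<Sum>k\<in>{k. 2 * k \<le> n}. f k * f (n - k)) + (\<Sum>k\<in>{k. 2 * k < n}. f k * f (n - k)))
     (suminf f * l + suminf f * l) (suminf f * e + suminf f * e)"
    by (intro near_add near_half_sum f n) auto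
  then show ?thesis
    by (simp only: convolution_split[of f f] mult_2 distrib_right)
qed

lemma near_of_bound:
  assumes "\<And>n. \<bar>f n\<bar> \<le> e * wt n"
  shows "near f l (e + \<bar>l\<bar>)"
  unfolding near_def
proof (intro allI impI always_eventually)
  fix x n assume x: "x > e + \<bar>l\<bar>"
  have "\<bar>f n - l * wt n\<bar> \<le> \<bar>f n\<bar> + \<bar>l * wt n\<bar>" by (rule abs_triangle_ineq4)
  also have "\<dots> \<le> (e + \<bar>l\<bar>) * wt n" using assms[of n] by (simp add: abs_mult algebra_simps)
  also have "\<dots> \<le> x * wt n" using x by (intro mult_right_mono) auto
  finally show "\<bar>f n - l * wt n\<bar> \<le> x * wt n" .
qed

lemma near_0_mono:
  assumes "near f 0 e" "\<And>n. \<bar>g n\<bar> \<le> \<bar>f n\<bar>"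
  shows "near g 0 e"
  unfolding near_def
proof (intro allI impI)
  fix x assume "x > e"
  then have "\<forall>\<^sub>F n in sequentially. \<bar>f n - 0 * wt n\<bar> \<le> x * wt n"
    using assms(1) unfolding near_def by blast
  then show "\<forall>\<^sub>F n in sequentially. \<bar>g n - 0 * wt n\<bar> \<le> x * wt n"
    by eventually_elim (use assms(2) order_trans in auto)
qed

lemma near_of_limit:
  assumes "(\<lambda>n. f n / wt n) \<longlonglongrightarrow> l"
  shows "near f l 0"
  unfolding near_def
proof (intro allI impI)
  fix x :: real assume "x > 0"
  then have "\<forall>\<^sub>F n in sequentially. dist (f n / wt n) l < x"
    using assms by (auto simp: tendsto_iff)
  then show "\<forall>\<^sub>F n in sequentially. \<bar>f n - l * wt n\<bar> \<le> x * wt n"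
  proof eventually_elim
    case (elim n)
    have "\<bar>f n - l * wt n\<bar> = \<bar>f n / wt n - l\<bar> * wt n"
    proof -
      have "f n - l * wt n = (f n / wt n - l) * wt n" by (simp add: field_simps)
      then show ?thesis by (simp add: abs_mult)
    qed
    also have "\<dots> \<le> x * wt n"
      using elim by (intro mult_right_mono) (auto simp: dist_real_def)
    finally show ?case .
  qed
qed

text \<open>An error bound that can be improved repeatedly by \<open>x \<mapsto> s + \<theta> x\<close> can be replaced by the fixed point of
  this map.\<close>

lemma near_contraction:
  assumes step: "\<And>x. near f l x \<Longrightarrow> near f l (s + \<theta> * x)"
    and start: "near f l x0" and \<theta>: "0 \<le> \<theta>" "\<theta> < 1"
  shows "near f l (s / (1 - \<theta>))"
proof -
  define y where "y = s / (1 - \<theta>)"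
  have y: "s + \<theta> * y = y" using \<theta> by (simp add: y_def field_simps)
  have near: "near f l (y + \<theta> ^ k * (x0 - y))" for k
  proof (induction k)
    case 0
    then show ?case using start by simp
  next
    case (Suc k)
    have "s + \<theta> * (y + \<theta> ^ k * (x0 - y)) = (s + \<theta> * y) + \<theta> ^ Suc k * (x0 - y)"
      by (simp add: algebra_simps)
    then show ?case using step[OF Suc] by (simp only: y)
  qed
  have "(\<lambda>k. y + \<theta> ^ k * (x0 - y)) \<longlonglongrightarrow> y + 0 * (x0 - y)"
    using \<theta> by (intro tendsto_intros LIMSEQ_power_zero) auto
  then have lim: "(\<lambda>k. y + \<theta> ^ k * (x0 - y)) \<longlonglongrightarrow> y" by simp
  have "near f l y"
    unfolding near_def
  proof (intro allI impI)
    fix x assume "x > y"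
    then have "\<forall>\<^sub>F k in sequentially. y + \<theta> ^ k * (x0 - y) < x"
      using lim by (intro order_tendstoD)
    then obtain k where "y + \<theta> ^ k * (x0 - y) < x"
      by (auto simp: eventually_at_top_linorder)
    then show "\<forall>\<^sub>F n in sequentially. \<bar>f n - l * wt n\<bar> \<le> x * wt n"
      using near[of k] unfolding near_def by blast
  qed
  then show ?thesis by (simp add: y_def)
qed

text \<open>The approximate limit \<open>l\<close> may depend on the error, so the limit comes from the Cauchy criterion.\<close>

lemma near_imp_convergent:
  assumes "\<And>\<delta>. \<delta> > 0 \<Longrightarrow> \<exists>l e. e < \<delta> \<and> near f l e"
  shows "convergent (\<lambda>n. f n / wt n)"
proof -
  have "Cauchy (\<lambda>n. f n / wt n)"
  proof (rule metric_CauchyI)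
    fix x :: real assume x: "x > 0"
    then obtain l e where "e < x / 3" "near f l e" using assms[of "x / 3"] by auto
    then have "\<forall>\<^sub>F n in sequentially. \<bar>f n - l * wt n\<bar> \<le> x / 3 * wt n"
      unfolding near_def by blast
    then obtain N where N: "\<And>n. n \<ge> N \<Longrightarrow> \<bar>f n - l * wt n\<bar> \<le> x / 3 * wt n"
      by (auto simp: eventually_at_top_linorder)
    have close: "\<bar>f n / wt n - l\<bar> \<le> x / 3" if "n \<ge> N" for n
    proof -
      have "f n / wt n - l = (f n - l * wt n) / wt n" by (simp add: field_simps)
      then have "\<bar>f n / wt n - l\<bar> = \<bar>f n - l * wt n\<bar> / wt n" by (simp add: abs_divide)
      then show ?thesis using N[OF that] by (simp add: divide_le_eq)
    qed
    have "dist (f i / wt i) (f j / wt j) < x" if "i \<ge> N" "j \<ge> N" for i j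
      using close[OF that(1)] close[OF that(2)] x unfolding dist_real_def by linarith
    then show "\<exists>N. \<forall>i\<ge>N. \<forall>j\<ge>N. dist (f i / wt i) (f j / wt j) < x" by blast
  qed
  then show ?thesis by (simp add: Cauchy_convergent_iff)
qed

text \<open>The solution of a renewal equation inherits the order of its data as long as the total mass of \<open>T\<close> is
  less than \<open>1\<close>. A bound \<open>W k \<le> D * wt k\<close> for \<open>k < n\<close> contributes asymptotically only
  \<open>suminf T * D * wt n\<close> through the half of the convolution with small indices of \<open>T\<close>; the other half is
  at most \<open>wt n\<close> times a constant independent of \<open>D\<close>, because \<open>W\<close> is summable. So a large \<open>D\<close> reproduces itself.\<close>

lemma renewal_bound:
  fixes T p W :: "nat \<Rightarrow> real"
  assumes eq: "\<And>n. W n = p n + (\<Sum>k=0..n. T k * W (n - k))"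
    and nonneg: "\<And>n. T n \<ge> 0" "\<And>n. p n \<ge> 0" "\<And>n. W n \<ge> 0"
    and T0: "T 0 = 0" and bound: "\<And>n. T n \<le> B * wt n" "\<And>n. p n \<le> B * wt n"
    and less_1: "suminf T < 1"
  shows "\<exists>D\<ge>0. \<forall>n. W n \<le> D * wt n"
proof -
  have summ: "summable T" "summable p"
    by (rule summable_comparison_test[OF _ summable_mult[OF summable_wt, of B]];
        use nonneg bound in \<open>auto simp: abs_of_nonneg\<close>)+
  define \<tau> where "\<tau> = suminf T"
  have \<tau>: "0 \<le> \<tau>" "\<tau> < 1"
    using less_1 suminf_nonneg[OF summ(1)] nonneg by (auto simp: \<tau>_def)
  have B: "B \<ge> 0"
    using order_trans[OF nonneg(2) bound(2), of 0] wt_pos[of 0] by (simp add: zero_le_mult_iff not_le)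
  have "summable W"
  proof (rule bounded_imp_summable[OF nonneg(3)])
    fix N
    have "(\<Sum>n\<le>N. W n) = (\<Sum>n\<le>N. p n) + (\<Sum>n\<le>N. \<Sum>k\<le>n. T k * W (n - k))"
      by (subst eq) (simp add: sum.distrib atLeast0AtMost)
    also have "(\<Sum>n\<le>N. \<Sum>k\<le>n. T k * W (n - k)) = (\<Sum>(i, j)\<in>{(i, j). i + j \<le> N}. T i * W j)"
      by (rule sum.triangle_reindex_eq[symmetric])
    also have "\<dots> \<le> (\<Sum>(i, j)\<in>{..N} \<times> {..N}. T i * W j)"
      by (rule sum_mono2) (auto intro!: mult_nonneg_nonneg nonneg)
    also have "\<dots> = (\<Sum>i\<le>N. T i) * (\<Sum>j\<le>N. W j)"
      by (simp add: sum_product sum.cartesian_product)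
    also have "\<dots> \<le> \<tau> * (\<Sum>j\<le>N. W j)"
      unfolding \<tau>_def using summ nonneg by (intro mult_right_mono sum_le_suminf sum_nonneg) auto
    also have "(\<Sum>n\<le>N. p n) \<le> suminf p"
      using summ nonneg by (intro sum_le_suminf) auto
    finally have "(1 - \<tau>) * (\<Sum>n\<le>N. W n) \<le> suminf p" by (simp add: algebra_simps)
    then show "(\<Sum>n\<le>N. W n) \<le> suminf p / (1 - \<tau>)"
      using \<tau> by (simp add: field_simps)
  qed
  define \<omega> where "\<omega> = suminf W"
  have \<omega>: "\<omega> \<ge> 0" unfolding \<omega>_def using \<open>summable W\<close> nonneg by (simp add: suminf_nonneg)
  define \<theta> where "\<theta> = (1 + \<tau>) / 2"
  have \<theta>: "\<tau> < \<theta>" "\<theta> < 1" using \<tau> by (auto simp: \<theta>_def)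
  have "(\<lambda>n. (\<Sum>k\<in>{k. 2 * k \<le> n}. T k * wt (n - k)) / wt n) \<longlonglongrightarrow> \<tau>"
    unfolding \<tau>_def by (rule half_sum_tendsto) (auto simp: summ nonneg)
  then have "\<forall>\<^sub>F n in sequentially. (\<Sum>k\<in>{k. 2 * k \<le> n}. T k * wt (n - k)) / wt n < \<theta>"
    using \<theta>(1) by (rule order_tendstoD)
  then obtain N where N: "\<And>n. n \<ge> N \<Longrightarrow> (\<Sum>k\<in>{k. 2 * k \<le> n}. T k * wt (n - k)) \<le> \<theta> * wt n"
    by (force simp: eventually_at_top_linorder field_simps)
  \<comment> \<open>The first summand makes the induction step close, the second covers the start \<open>n \<le> N\<close>.\<close>
  define D where "D = (B + 3 * B * \<omega>) / (1 - \<theta>) + (\<Sum>n\<le>N. W n / wt n)"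
  have D0: "D \<ge> 0" unfolding D_def using B \<omega> \<theta> nonneg by (intro add_nonneg_nonneg sum_nonneg) auto
  have D: "B + D * \<theta> + 3 * B * \<omega> \<le> D"
  proof -
    have "(B + 3 * B * \<omega>) / (1 - \<theta>) \<le> D"
      unfolding D_def using nonneg by (simp add: sum_nonneg)
    then show ?thesis using \<theta> by (simp add: field_simps)
  qed
  have "W n \<le> D * wt n" for n
  proof (induction n rule: less_induct)
    case (less n)
    show ?case
    proof (cases "n \<le> N")
      case True
      have "W n / wt n \<le> (\<Sum>n\<le>N. W n / wt n)"
        using True nonneg by (intro member_le_sum) auto
      also have "\<dots> \<le> D" unfolding D_def using B \<omega> \<theta> by simp
      finally show ?thesis by (simp add: field_simps)
    next
      case False
      have "(\<Sum>k\<in>{k. 2 * k \<le> n}. T k * W (n - k)) \<le> (\<Sum>k\<in>{k. 2 * k \<le> n}. T k * (D * wt (n - k)))"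
      proof (rule sum_mono)
        fix k assume "k \<in> {k. 2 * k \<le> n}"
        show "T k * W (n - k) \<le> T k * (D * wt (n - k))"
        proof (cases "k = 0")
          case True
          then show ?thesis using T0 by simp
        next
          case k: False
          have "W (n - k) \<le> D * wt (n - k)" using False k by (intro less) auto
          then show ?thesis by (intro mult_left_mono nonneg)
        qed
      qed
      also have "\<dots> = D * (\<Sum>k\<in>{k. 2 * k \<le> n}. T k * wt (n - k))"
        by (simp add: sum_distrib_left mult_ac)
      also have "\<dots> \<le> D * (\<theta> * wt n)"
        using N[of n] False D0 by (intro mult_left_mono) auto
      finally have 1: "(\<Sum>k\<in>{k. 2 * k \<le> n}. T k * W (n - k)) \<le> D * \<theta> * wt n" by simp
      have "(\<Sum>k\<in>{k. 2 * k < n}. W k * T (n - k)) \<le> (\<Sum>k\<in>{k. 2 * k < n}. W k * (3 * B * wt n))"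
      proof (intro sum_mono mult_left_mono nonneg)
        fix k assume "k \<in> {k. 2 * k < n}"
        then have "wt (n - k) \<le> 3 * wt n" by (intro wt_half_le) auto
        then have "B * wt (n - k) \<le> B * (3 * wt n)" using B by (intro mult_left_mono)
        then show "T (n - k) \<le> 3 * B * wt n" using bound(1)[of "n - k"] by simp
      qed
      also have "\<dots> = (\<Sum>k\<in>{k. 2 * k < n}. W k) * (3 * B * wt n)"
        by (simp add: sum_distrib_right)
      also have "\<dots> \<le> \<omega> * (3 * B * wt n)"
        unfolding \<omega>_def using B nonneg \<open>summable W\<close>
        by (intro mult_right_mono sum_le_suminf) (auto intro: finite_subset[of _ "{..n}"])
      finally have 2: "(\<Sum>k\<in>{k. 2 * k < n}. W k * T (n - k)) \<le> 3 * B * \<omega> * wt n" by (simp add: mult_ac)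
      have "W n \<le> B * wt n + D * \<theta> * wt n + 3 * B * \<omega> * wt n"
        using 1 2 bound(2)[of n] by (subst eq) (simp add: convolution_split)
      also have "\<dots> = (B + D * \<theta> + 3 * B * \<omega>) * wt n" by (simp add: algebra_simps)
      also have "\<dots> \<le> D * wt n" using D by (intro mult_right_mono) auto
      finally show ?thesis .
    qed
  qed
  with D0 show ?thesis by blast
qed


section \<open>The dominant singularity\<close>

lemma sqrt_coeff_tendsto:
  "(\<lambda>n. ((1/2 :: complex) gchoose n) * (-1) ^ n / of_real (wt n)) \<longlonglongrightarrow> inverse (Gamma (-1/2))"
proof -
  have "(\<lambda>n. ((1/2 :: complex) gchoose n) / ((-1) ^ n / exp ((1/2 + 1) * of_real (ln (real n)))))
      \<longlonglongrightarrow> inverse (Gamma (- (1/2)))"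
    by (rule gbinomial_asymptotic)
  moreover have "(\<lambda>n. complex_of_real (real n powr (-3/2) / wt n)) \<longlonglongrightarrow> of_real 1"
  proof (rule tendsto_of_real)
    show "(\<lambda>n. real n powr (-3/2) / wt n) \<longlonglongrightarrow> 1"
      unfolding wt_def of_nat_Suc by real_asymp
  qed
  ultimately have "(\<lambda>n. ((1/2 :: complex) gchoose n) / ((-1) ^ n / exp ((1/2 + 1) * of_real (ln (real n))))
      * of_real (real n powr (-3/2) / wt n)) \<longlonglongrightarrow> inverse (Gamma (- (1/2))) * of_real 1"
    by (rule tendsto_mult)
  moreover have "eventually (\<lambda>n. ((1/2 :: complex) gchoose n) / ((-1) ^ n / exp ((1/2 + 1) * of_real (ln (real n))))
      * of_real (real n powr (-3/2) / wt n) = ((1/2) gchoose n) * (-1) ^ n / of_real (wt n)) sequentially"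
    using eventually_gt_at_top[of 0]
  proof eventually_elim
    case (elim n)
    have "exp ((1/2 + 1) * complex_of_real (ln (real n))) = of_real (exp (3/2 * ln (real n)))"
      by (simp flip: exp_of_real)
    also have "exp (3/2 * ln (real n)) = real n powr (3/2)"
      using elim by (simp add: powr_def)
    finally have e: "exp ((1/2 + 1) * complex_of_real (ln (real n))) = of_real (real n powr (3/2))" .
    have 1: "of_real (real n powr (3/2)) * complex_of_real (real n powr (-3/2)) = 1"
      using elim by (simp flip: of_real_mult powr_add)
    have s: "x / (-1) ^ n = x * (-1) ^ n" for x :: complex
      by (cases "even n") auto
    have "((1/2 :: complex) gchoose n) / ((-1) ^ n / of_real (real n powr (3/2)))
      * of_real (real n powr (-3/2) / wt n) = ((1/2) gchoose n) / (-1) ^ n *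
        (of_real (real n powr (3/2)) * complex_of_real (real n powr (-3/2))) / of_real (wt n)"
      by simp
    then show ?case unfolding e 1 s by simp
  qed
  ultimately show ?thesis by (simp add: filterlim_cong)
qed

text \<open>The binomial series gives the formal square root of \<open>1 - x X\<close>.\<close>

lemma sqrt_linear:
  "(fps_binomial (1/2) oo (fps_const (- x) * fps_X))\<^sup>2 =
    1 - fps_const x * (fps_X :: complex fps)"
proof -
  define Y :: "complex fps" where "Y = fps_const (- x) * fps_X"
  have Y: "fps_nth Y 0 = 0" by (simp add: Y_def)
  have "(fps_binomial (1/2) oo Y)\<^sup>2 = (fps_binomial (1/2) * fps_binomial (1/2)) oo Y"
    by (simp add: fps_compose_mult_distrib[OF Y] power2_eq_square)
  also have "fps_binomial (1/2) * fps_binomial (1/2) = 1 + (fps_X :: complex fps)"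
    by (simp add: fps_binomial_1 flip: fps_binomial_add_mult)
  also have "(1 + fps_X) oo Y = 1 + Y"
    using Y by (simp add: fps_compose_add_distrib)
  finally show ?thesis by (simp add: Y_def flip: fps_const_neg)
qed

lemma summable_poly_weight:
  fixes G :: "complex fps"
  assumes rho_pos: "\<rho> > 0" and "fps_conv_radius G \<ge> ereal r" "r > \<rho>"
  shows "summable (\<lambda>k. (real k + 1) powr (3/2) * norm (fps_nth G k * of_real \<rho> ^ k))"
proof -
  obtain s where s: "\<rho> < s" "s < r" using assms dense by blast
  have s_pos: "s > 0" using s rho_pos by simp
  define t where "t = \<rho> / s"
  have t: "0 < t" "t < 1" using s rho_pos by (auto simp: t_def)
  have lim: "(\<lambda>k. (real k + 1) powr (3/2) * t ^ k) \<longlonglongrightarrow> 0"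
    using t by real_asymp
  obtain B where B: "\<And>k. norm ((real k + 1) powr (3/2) * t ^ k) \<le> B"
    using convergent_imp_Bseq[OF convergentI[OF lim]] unfolding Bseq_def by blast
  have "ereal (norm (of_real s :: complex)) < fps_conv_radius G"
    using s s_pos assms by (auto intro: less_le_trans[of _ "ereal r"])
  then have "summable (\<lambda>k. norm (fps_nth G k * of_real s ^ k))"
    by (rule norm_summable_fps)
  then have "summable (\<lambda>k. B * norm (fps_nth G k * of_real s ^ k))"
    by (rule summable_mult)
  then show ?thesis
  proof (rule summable_comparison_test[rotated], intro exI allI impI)
    fix k
    have "\<rho> ^ k = t ^ k * s ^ k" using s_pos by (simp add: t_def power_divide)
    then have "norm ((real k + 1) powr (3/2) * norm (fps_nth G k * of_real \<rho> ^ k)) =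
        ((real k + 1) powr (3/2) * t ^ k) * norm (fps_nth G k * of_real s ^ k)"
      using rho_pos s_pos t by (simp add: norm_mult norm_power abs_mult)
    also have "\<dots> \<le> B * norm (fps_nth G k * of_real s ^ k)"
      using B[of k] t by (intro mult_right_mono) auto
    finally show "norm ((real k + 1) powr (3/2) * norm (fps_nth G k * of_real \<rho> ^ k))
        \<le> B * norm (fps_nth G k * of_real s ^ k)" .
  qed
qed

definition complex_fps :: "real fps \<Rightarrow> complex fps" where
  "complex_fps f = Abs_fps (\<lambda>n. of_real (fps_nth f n))"

lemma complex_fps_nth [simp]: "fps_nth (complex_fps f) n = of_real (fps_nth f n)"
  by (simp add: complex_fps_def)

lemma complex_fps_simps:
  "complex_fps (f + g) = complex_fps f + complex_fps g"
  "complex_fps (f - g) = complex_fps f - complex_fps g"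
  "complex_fps (f * g) = complex_fps f * complex_fps g"
  "complex_fps 1 = 1" "complex_fps (numeral k) = numeral k" "complex_fps fps_X = fps_X"
  by (simp_all add: fps_eq_iff fps_mult_nth fps_numeral_nth fps_X_def)

lemma complex_fps_power: "complex_fps (f ^ n) = complex_fps f ^ n"
  by (induction n) (simp_all add: complex_fps_simps)

text \<open>Equality in the triangle inequality.\<close>

lemma norm_one_minus_eq:
  fixes w :: complex
  assumes "norm (1 - w) = 1 - norm w"
  shows "w = of_real (norm w)"
proof -
  have "(norm (1 - w))\<^sup>2 = (1 - Re w)\<^sup>2 + (Im w)\<^sup>2"
    by (simp add: cmod_power2)
  also have "\<dots> = 1 - 2 * Re w + (norm w)\<^sup>2"
    unfolding cmod_power2 by (simp add: power2_eq_square algebra_simps)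
  finally have re: "Re w = norm w"
    unfolding assms by (simp add: power2_eq_square algebra_simps)
  then have "Im w = 0"
    using cmod_power2[of w] by simp
  with re show ?thesis by (simp add: complex_eq_iff)
qed

lemma power_eq_1_gcd:
  fixes u :: complex
  assumes "u ^ m = 1" "u ^ n = 1"
  shows "u ^ gcd m n = 1"
proof (cases "m = 0")
  case False
  obtain x y where "m * x = n * y + gcd m n"
    using bezout_nat[OF False] by blast
  then have "u ^ (m * x) = u ^ (n * y) * u ^ gcd m n" by (simp add: power_add)
  then show ?thesis using assms by (simp add: power_mult)
qed (use assms in simp)

locale term_size_params =
  fixes a b c d :: nat and \<rho> :: real
  assumes ad_pos: "a + d \<ge> 1" and b_pos: "b \<ge> 1" and c_pos: "c \<ge> 1"
    and gcd_1: "gcd b (gcd c (a + d)) = 1"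
    and rho_pos: "\<rho> > 0"
    and rho_root: "(1 - \<rho> ^ b) * (1 - \<rho> ^ c)\<^sup>2 - 4 * \<rho> ^ (a + d) = 0"
    and rho_least: "\<And>z::real. z > 0 \<Longrightarrow> (1 - z ^ b) * (1 - z ^ c)\<^sup>2 - 4 * z ^ (a + d) = 0 \<Longrightarrow> \<rho> \<le> z"
begin

lemmas size_pos = ad_pos b_pos c_pos

definition discr :: "complex poly" where
  "discr = (1 - monom 1 b) * (1 - monom 1 c)\<^sup>2 - 4 * monom 1 (a + d)"

lemma poly_discr: "poly discr z = (1 - z ^ b) * (1 - z ^ c)\<^sup>2 - 4 * z ^ (a + d)"
  by (simp add: discr_def poly_monom)

text \<open>The discriminant is \<open>1\<close> at \<open>0\<close>, so it has a root before any point where it is nonpositive.\<close>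

lemma rho_le_of_discr_nonpos:
  assumes "x \<ge> 0" "(1 - x ^ b) * (1 - x ^ c)\<^sup>2 - 4 * x ^ (a + d) \<le> 0"
  shows "\<rho> \<le> x"
proof -
  define f where "f x = (1 - x ^ b) * (1 - x ^ c)\<^sup>2 - 4 * x ^ (a + d)" for x :: real
  have f0: "f 0 = 1" using size_pos by (auto simp: f_def power_0_left)
  have "\<exists>z\<ge>0. z \<le> x \<and> f z = 0"
    using assms f0 unfolding f_def by (intro IVT2') (auto intro!: continuous_intros)
  then obtain z where z: "0 \<le> z" "z \<le> x" "f z = 0" by blast
  moreover have "z \<noteq> 0" using z f0 by auto
  ultimately show ?thesis using rho_least[of z] by (auto simp: f_def)
qed

lemma rho_less_1: "\<rho> < 1"
proof -
  have "\<rho> \<le> 1" by (rule rho_le_of_discr_nonpos) (use size_pos in auto)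
  moreover have "\<rho> \<noteq> 1" using rho_root size_pos by auto
  ultimately show ?thesis by simp
qed

lemma rho_power_less_1: "k \<ge> 1 \<Longrightarrow> \<rho> ^ k < 1"
  using rho_pos rho_less_1 by (simp add: power_less_one_iff)

text \<open>For \<open>\<bar>z\<bar> = r\<close> the equation for a root gives \<open>(1 - r\<^sup>b) (1 - r\<^sup>c)\<^sup>2 \<le> 4 r\<^bsup>a+d\<^esup>\<close>, so \<open>r\<close> cannot be below \<open>\<rho>\<close>. At
  \<open>r = \<rho>\<close> all triangle inequalities are equalities, so that \<open>z\<^sup>b\<close>, \<open>z\<^sup>c\<close> and hence \<open>z\<^bsup>a+d\<^esup>\<close> are positive
  reals; as \<open>gcd b (gcd c (a + d)) = 1\<close>, so is \<open>z\<close>.\<close>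

lemma discr_root_unique:
  assumes root: "poly discr z = 0" and norm_le: "norm z \<le> \<rho>"
  shows "z = of_real \<rho>"
proof -
  define r where "r = norm z"
  have r: "0 \<le> r" "r \<le> \<rho>" "r < 1" using norm_le rho_less_1 by (auto simp: r_def)
  have eq: "(1 - z ^ b) * (1 - z ^ c)\<^sup>2 = 4 * z ^ (a + d)"
    using root by (simp add: poly_discr)
  have norm_eq: "norm (1 - z ^ b) * (norm (1 - z ^ c))\<^sup>2 = 4 * r ^ (a + d)"
    using arg_cong[OF eq, of norm] by (simp add: norm_mult norm_power r_def)
  have ge: "norm (1 - z ^ k) \<ge> 1 - r ^ k" for k
    using norm_triangle_ineq2[of 1 "z ^ k"] by (simp add: norm_power r_def)
  have pos: "1 - r ^ k \<ge> 0" for k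
    using r by (simp add: power_le_one)
  have "(1 - r ^ b) * (1 - r ^ c)\<^sup>2 \<le> norm (1 - z ^ b) * (norm (1 - z ^ c))\<^sup>2"
    by (intro mult_mono power_mono ge pos) auto
  then have "\<rho> \<le> r"
    using r norm_eq by (intro rho_le_of_discr_nonpos) auto
  with r have r_eq: "r = \<rho>" by simp
  have pos': "1 - \<rho> ^ b > 0" "1 - \<rho> ^ c > 0"
    using rho_power_less_1 size_pos by auto
  have tot: "norm (1 - z ^ b) * (norm (1 - z ^ c))\<^sup>2 = (1 - \<rho> ^ b) * (1 - \<rho> ^ c)\<^sup>2"
    using norm_eq rho_root r_eq by simp
  \<comment> \<open>Each factor is at least its value at \<open>\<rho>\<close>, so equality of the products forces equality of the
    factors.\<close>
  have nb: "norm (1 - z ^ b) = 1 - \<rho> ^ b"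
  proof (rule ccontr)
    assume "norm (1 - z ^ b) \<noteq> 1 - \<rho> ^ b"
    then have "1 - \<rho> ^ b < norm (1 - z ^ b)" using ge[of b] r_eq by simp
    then have "(1 - \<rho> ^ b) * (1 - \<rho> ^ c)\<^sup>2 < norm (1 - z ^ b) * (1 - \<rho> ^ c)\<^sup>2"
      using pos' by (intro mult_strict_right_mono) auto
    also have "\<dots> \<le> norm (1 - z ^ b) * (norm (1 - z ^ c))\<^sup>2"
      using ge[of c] r_eq pos' by (intro mult_left_mono power_mono) auto
    finally show False using tot by simp
  qed
  have "(norm (1 - z ^ c))\<^sup>2 = (1 - \<rho> ^ c)\<^sup>2"
    using tot nb pos' by simp
  then have nc: "norm (1 - z ^ c) = 1 - \<rho> ^ c"
    using pos' by (simp add: power2_eq_iff_nonneg)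
  have zb: "z ^ b = of_real (\<rho> ^ b)"
    using norm_one_minus_eq[of "z ^ b"] nb r_eq by (simp add: norm_power r_def)
  have zc: "z ^ c = of_real (\<rho> ^ c)"
    using norm_one_minus_eq[of "z ^ c"] nc r_eq by (simp add: norm_power r_def)
  have "4 * z ^ (a + d) = of_real ((1 - \<rho> ^ b) * (1 - \<rho> ^ c)\<^sup>2)"
    unfolding eq[symmetric] zb zc by simp
  also have "(1 - \<rho> ^ b) * (1 - \<rho> ^ c)\<^sup>2 = 4 * \<rho> ^ (a + d)"
    using rho_root by simp
  finally have zad: "z ^ (a + d) = of_real (\<rho> ^ (a + d))" by simp
  define u where "u = z / of_real \<rho>"
  have "u ^ b = 1" "u ^ c = 1" "u ^ (a + d) = 1"
    using zb zc zad rho_pos unfolding u_def power_divide by simp_all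
  then have "u ^ gcd b (gcd c (a + d)) = 1" by (intro power_eq_1_gcd)
  then show ?thesis using rho_pos by (simp add: gcd_1 u_def)
qed

text \<open>The root is simple because the derivative of the discriminant is negative at \<open>\<rho>\<close>.\<close>

lemma discr_factor:
  obtains q where "discr = [:1, - 1 / of_real \<rho>:] * q" "poly q (of_real \<rho>) \<noteq> 0"
proof -
  have root: "poly discr (of_real \<rho>) = 0"
  proof -
    have "poly discr (of_real \<rho>) = of_real ((1 - \<rho> ^ b) * (1 - \<rho> ^ c)\<^sup>2 - 4 * \<rho> ^ (a + d))"
      by (simp add: poly_discr)
    then show ?thesis using rho_root by simp
  qed
  then obtain q' where q': "discr = [:- of_real \<rho>, 1:] * q'"
    by (auto simp: poly_eq_0_iff_dvd)
  define q where "q = smult (- of_real \<rho>) q'"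
  have lin: "[:- of_real \<rho>, 1:] = smult (- of_real \<rho>) [:1, - 1 / of_real \<rho> :: complex:]"
    using rho_pos by simp
  have q: "discr = [:1, - 1 / of_real \<rho>:] * q"
    by (simp only: q' q_def lin mult_smult_left mult_smult_right)
  have "poly (pderiv discr) (of_real \<rho>) = of_real
      (- (real b * \<rho> ^ (b - 1) * (1 - \<rho> ^ c)\<^sup>2) - 2 * (1 - \<rho> ^ b) * (1 - \<rho> ^ c) * (real c * \<rho> ^ (c - 1))
       - 4 * (real (a + d) * \<rho> ^ (a + d - 1)))"
    unfolding discr_def power2_eq_square
    by (simp add: pderiv_diff pderiv_mult pderiv_monom poly_monom pderiv_numeral)
  moreover have "- (real b * \<rho> ^ (b - 1) * (1 - \<rho> ^ c)\<^sup>2)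
      - 2 * (1 - \<rho> ^ b) * (1 - \<rho> ^ c) * (real c * \<rho> ^ (c - 1))
       - 4 * (real (a + d) * \<rho> ^ (a + d - 1)) < 0"
  proof -
    have "1 - \<rho> ^ b > 0" "1 - \<rho> ^ c > 0"
      using rho_power_less_1 size_pos by auto
    then have "(real b * \<rho> ^ (b - 1)) * (1 - \<rho> ^ c)\<^sup>2 \<ge> 0"
      "2 * (1 - \<rho> ^ b) * (1 - \<rho> ^ c) * (real c * \<rho> ^ (c - 1)) \<ge> 0"
      "real (a + d) * \<rho> ^ (a + d - 1) > 0"
      using rho_pos size_pos by (auto intro!: mult_nonneg_nonneg mult_pos_pos)
    then show ?thesis by linarith
  qed
  ultimately have "poly (pderiv discr) (of_real \<rho>) \<noteq> 0"
    by (metis of_real_eq_0_iff less_irrefl)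
  moreover have "poly (pderiv discr) (of_real \<rho>) = - 1 / of_real \<rho> * poly q (of_real \<rho>)"
    using rho_pos unfolding q pderiv_mult by (simp add: pderiv_pCons)
  ultimately have "poly q (of_real \<rho>) \<noteq> 0" by auto
  with q show ?thesis by (rule that)
qed

text \<open>After division by \<open>(1 - z / \<rho>) (1 - z\<^sup>b)\<close> the discriminant has neither zeros nor poles in a disc of radius
  \<open>r > \<rho>\<close>, so it has a holomorphic square root there.\<close>

lemma sqrt_factor:
  obtains G :: "complex fps" and r where "r > \<rho>" "fps_conv_radius G \<ge> ereal r"
    "eval_fps G (of_real \<rho>) \<noteq> 0"
    "(1 - fps_const (1 / of_real \<rho>) * fps_X) * G\<^sup>2 * (1 - fps_X ^ b) = fps_of_poly discr"
proof -
  obtain q where q: "discr = [:1, - 1 / of_real \<rho>:] * q" and q_rho: "poly q (of_real \<rho>) \<noteq> 0"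
    by (rule discr_factor)
  define Z where "Z = {z. poly q z = 0}"
  have "q \<noteq> 0" using q_rho by auto
  then have fin: "finite Z" unfolding Z_def by (rule poly_roots_finite)
  have Z: "norm z > \<rho>" if "z \<in> Z" for z
  proof (rule ccontr)
    assume "\<not> norm z > \<rho>"
    moreover have "poly discr z = 0" using that by (simp add: q Z_def)
    ultimately have "z = of_real \<rho>" by (intro discr_root_unique) auto
    then show False using that q_rho by (simp add: Z_def)
  qed
  \<comment> \<open>Below \<open>1\<close> the factor \<open>1 - z\<^sup>b\<close> has no zeros; below the modulus of the zeros of \<open>q\<close> neither has \<open>q\<close>.\<close>
  define r where "r = Min (insert 1 (norm ` Z))"
  have r: "r > \<rho>" using fin Z rho_less_1 by (simp add: r_def)
  have r_le: "r \<le> 1" "\<And>z. z \<in> Z \<Longrightarrow> r \<le> norm z" using fin by (auto simp: r_def)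
  have den: "1 - z ^ b \<noteq> 0" if "z \<in> ball 0 r" for z :: complex
  proof
    assume "1 - z ^ b = 0"
    then have "norm z ^ b = 1" by (simp flip: norm_power)
    moreover have "norm z ^ b < 1" using that r_le b_pos by (subst power_less_one_iff) auto
    ultimately show False by simp
  qed
  define h where "h z = poly q z / (1 - z ^ b)" for z
  have "h holomorphic_on ball 0 r"
    unfolding h_def using den by (intro holomorphic_intros) auto
  moreover have "h z \<noteq> 0" if "z \<in> ball 0 r" for z
    using den[OF that] r_le(2)[of z] that by (auto simp: h_def Z_def)
  ultimately obtain g where g: "g holomorphic_on ball 0 r" "\<And>z. z \<in> ball 0 r \<Longrightarrow> h z = g z ^ 2"
    by (metis contractible_imp_holomorphic_sqrt convex_imp_contractible convex_ball)
  define G where "G = fps_expansion g 0"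
  have r_pos: "r > 0" using r rho_pos by simp
  have g': "g holomorphic_on eball 0 (ereal r)" using g by simp
  have G: "g has_fps_expansion G"
    unfolding G_def by (rule has_fps_expansion_fps_expansion[OF _ _ g(1)]) (use r_pos in auto)
  have radius: "fps_conv_radius G \<ge> ereal r"
    unfolding G_def by (rule conv_radius_fps_expansion[OF g'])
  have "eval_fps G (of_real \<rho>) = g (of_real \<rho>)"
    unfolding G_def using eval_fps_expansion'[OF g', of "of_real \<rho>"] r rho_pos by simp
  moreover have "g (of_real \<rho>) \<noteq> 0"
  proof -
    have "of_real \<rho> \<in> ball (0::complex) r" using r rho_pos by simp
    then have "g (of_real \<rho>) ^ 2 = poly q (of_real \<rho>) / (1 - of_real \<rho> ^ b)" "1 - of_real \<rho> ^ b \<noteq> (0::complex)"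
      using g(2) den by (auto simp: h_def)
    then show ?thesis using q_rho by auto
  qed
  ultimately have nz: "eval_fps G (of_real \<rho>) \<noteq> 0" by simp
  have "(\<lambda>z. g z * g z * (1 - z ^ b)) has_fps_expansion G * G * (1 - fps_X ^ b)"
    by (intro fps_expansion_intros G)
  moreover have "eventually (\<lambda>z. g z * g z * (1 - z ^ b) = poly q z) (nhds 0)"
  proof -
    have "eventually (\<lambda>z::complex. z \<in> ball 0 r) (nhds 0)"
      using r_pos by (intro eventually_nhds_in_open) auto
    then show ?thesis
    proof eventually_elim
      case (elim z)
      then show ?case using g(2)[OF elim] den[OF elim] by (simp add: h_def power2_eq_square field_simps)
    qed
  qed
  ultimately have "poly q has_fps_expansion G * G * (1 - fps_X ^ b)"
    by (simp add: has_fps_expansion_cong)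
  moreover have "poly q has_fps_expansion fps_of_poly q"
    by (simp add: has_fps_expansion_def)
  ultimately have "G * G * (1 - fps_X ^ b) = fps_of_poly q"
    by (rule fps_expansion_unique_complex)
  then have "(1 - fps_const (1 / of_real \<rho>) * fps_X) * G\<^sup>2 * (1 - fps_X ^ b) = fps_of_poly discr"
    by (simp add: q fps_of_poly_mult fps_of_poly_linear' power2_eq_square mult.assoc flip: fps_const_neg)
  with r radius nz show ?thesis by (rule that)
qed

subsection \<open>Terms with arbitrary free indices\<close>

abbreviation (input) U :: "real fps" where
  "U \<equiv> term_gf a b c d UNIV"

lemma U_eq: "U = index_gf a b UNIV + fps_X ^ c * U + fps_X ^ d * U\<^sup>2"
  by (rule term_gf_decomp[OF size_pos all_terms_decomp])

text \<open>Completing the square in the quadratic equation for \<open>U\<close>.\<close>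

lemma U_discr:
  "(1 - fps_X ^ c - 2 * fps_X ^ d * U)\<^sup>2 * (1 - fps_X ^ b) =
     (1 - fps_X ^ b) * (1 - fps_X ^ c)\<^sup>2 - 4 * fps_X ^ (a + d)"
proof -
  have quad: "fps_X ^ d * U\<^sup>2 = U - index_gf a b UNIV - fps_X ^ c * U"
    by (subst (2) U_eq) simp
  have "(1 - fps_X ^ c - 2 * fps_X ^ d * U)\<^sup>2 =
      (1 - fps_X ^ c)\<^sup>2 - 4 * fps_X ^ d * (1 - fps_X ^ c) * U + 4 * fps_X ^ d * (fps_X ^ d * U\<^sup>2)"
    by (simp add: power2_eq_square algebra_simps)
  also have "\<dots> = (1 - fps_X ^ c)\<^sup>2 - 4 * fps_X ^ d * index_gf a b UNIV"
    unfolding quad by (simp add: power2_eq_square algebra_simps)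
  finally have "(1 - fps_X ^ c - 2 * fps_X ^ d * U)\<^sup>2 * (1 - fps_X ^ b) =
      ((1 - fps_X ^ c)\<^sup>2 - 4 * fps_X ^ d * index_gf a b UNIV) * (1 - fps_X ^ b)"
    by simp
  also have "\<dots> = (1 - fps_X ^ b) * (1 - fps_X ^ c)\<^sup>2 - 4 * fps_X ^ d * (index_gf a b UNIV * (1 - fps_X ^ b))"
    by (simp add: algebra_simps)
  finally have "(1 - fps_X ^ c - 2 * fps_X ^ d * U)\<^sup>2 * (1 - fps_X ^ b) =
      (1 - fps_X ^ b) * (1 - fps_X ^ c)\<^sup>2 - 4 * fps_X ^ d * (index_gf a b UNIV * (1 - fps_X ^ b))" .
  then show ?thesis
    by (simp add: index_gf_UNIV[OF b_pos] power_add mult_ac)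
qed

text \<open>Formal square roots are unique up to sign, so \<open>S\<close> is plus or minus the product of the binomial series
  with \<open>G\<close>. The sign is left open here: only a nonzero limit is claimed.\<close>

lemma discr_sqrt_coeff_tendsto:
  obtains L :: complex where "L \<noteq> 0"
    "(\<lambda>n. of_real (fps_nth (1 - fps_X ^ c - 2 * fps_X ^ d * U) n * \<rho> ^ n / wt n)) \<longlonglongrightarrow> L"
proof -
  obtain G :: "complex fps" and r where r: "r > \<rho>" and radius: "fps_conv_radius G \<ge> ereal r"
    and G_rho: "eval_fps G (of_real \<rho>) \<noteq> 0"
    and G: "(1 - fps_const (1 / of_real \<rho>) * fps_X) * G\<^sup>2 * (1 - fps_X ^ b) = fps_of_poly discr"
    by (rule sqrt_factor)
  define B :: "complex fps" where "B = fps_binomial (1/2) oo (fps_const (- 1 / of_real \<rho>) * fps_X)"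
  define S where "S = complex_fps (1 - fps_X ^ c - 2 * fps_X ^ d * U)"
  have "S\<^sup>2 * (1 - fps_X ^ b) = complex_fps ((1 - fps_X ^ c - 2 * fps_X ^ d * U)\<^sup>2 * (1 - fps_X ^ b))"
    by (simp only: S_def complex_fps_simps complex_fps_power)
  also have "\<dots> = fps_of_poly discr"
    unfolding U_discr discr_def
    by (simp add: complex_fps_simps complex_fps_power fps_of_poly_simps fps_of_poly_monom')
  also have "\<dots> = (B * G)\<^sup>2 * (1 - fps_X ^ b)"
    using sqrt_linear[of "1 / of_real \<rho>"] by (simp add: G[symmetric] B_def power_mult_distrib)
  finally have "S\<^sup>2 * (1 - fps_X ^ b) = (B * G)\<^sup>2 * (1 - fps_X ^ b)" .
  moreover have "(1 - fps_X ^ b :: complex fps) \<noteq> 0"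
  proof -
    have "fps_nth (1 - fps_X ^ b :: complex fps) 0 = 1" using b_pos by simp
    then show ?thesis by (metis fps_zero_nth zero_neq_one)
  qed
  ultimately have "S\<^sup>2 = (B * G)\<^sup>2" by simp
  then have "S = B * G \<or> S = - (B * G)" by (simp add: power2_eq_iff)
  then obtain \<sigma> :: complex where \<sigma>: "\<sigma> \<noteq> 0" "S = fps_const \<sigma> * (B * G)"
    by (metis fps_const_1_eq_1 fps_const_neg mult_1 mult_minus_left zero_neq_one neg_equal_0_iff_equal)
  have B_nth: "fps_nth B n = (- 1 / of_real \<rho>) ^ n * ((1/2) gchoose n)" for n
    by (simp add: B_def fps_compose_linear)
  have "(\<lambda>n. (\<Sum>k\<le>n. (fps_nth G k * of_real \<rho> ^ k) * (((1/2) gchoose (n - k)) * (-1) ^ (n - k))) / of_real (wt n))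
      \<longlonglongrightarrow> (\<Sum>k. fps_nth G k * of_real \<rho> ^ k) * inverse (Gamma (-1/2))"
    by (rule convolution_tendsto[OF summable_poly_weight[OF rho_pos radius r] sqrt_coeff_tendsto])
  then have "(\<lambda>n. \<sigma> * ((\<Sum>k\<le>n. (fps_nth G k * of_real \<rho> ^ k) * (((1/2) gchoose (n - k)) * (-1) ^ (n - k))) / of_real (wt n)))
      \<longlonglongrightarrow> \<sigma> * ((\<Sum>k. fps_nth G k * of_real \<rho> ^ k) * inverse (Gamma (-1/2)))"
    by (rule tendsto_mult_left)
  moreover have "\<sigma> * ((\<Sum>k\<le>n. (fps_nth G k * of_real \<rho> ^ k) * (((1/2) gchoose (n - k)) * (-1) ^ (n - k))) / of_real (wt n))
      = of_real (fps_nth (1 - fps_X ^ c - 2 * fps_X ^ d * U) n * \<rho> ^ n / wt n)" for n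
  proof -
    let ?x = "\<Sum>k\<le>n. (fps_nth G k * of_real \<rho> ^ k) * (((1/2) gchoose (n - k)) * (-1) ^ (n - k))"
    have "of_real (fps_nth (1 - fps_X ^ c - 2 * fps_X ^ d * U) n) = fps_nth S n"
      by (simp only: S_def complex_fps_nth)
    also have "\<dots> = \<sigma> * fps_nth (G * B) n"
      by (simp add: \<sigma> mult.commute[of B])
    finally have nth: "of_real (fps_nth (1 - fps_X ^ c - 2 * fps_X ^ d * U) n) = \<sigma> * fps_nth (G * B) n" .
    have conv: "fps_nth (G * B) n * of_real \<rho> ^ n = ?x"
      unfolding fps_mult_nth sum_distrib_right atLeast0AtMost
    proof (rule sum.cong[OF refl])
      fix k assume "k \<in> {..n}"
      then have pw: "of_real \<rho> ^ n = of_real \<rho> ^ k * (of_real \<rho> ^ (n - k) :: complex)"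
        by (simp flip: power_add)
      have "(- 1 / of_real \<rho>) ^ (n - k) * of_real \<rho> ^ (n - k) = (-1 :: complex) ^ (n - k)"
        using rho_pos by (simp flip: power_mult_distrib)
      moreover have "fps_nth G k * fps_nth B (n - k) * of_real \<rho> ^ n =
          (fps_nth G k * of_real \<rho> ^ k) *
          (((1/2) gchoose (n - k)) * ((- 1 / of_real \<rho>) ^ (n - k) * of_real \<rho> ^ (n - k)))"
        unfolding B_nth pw by (simp only: mult_ac)
      ultimately show "fps_nth G k * fps_nth B (n - k) * of_real \<rho> ^ n =
          (fps_nth G k * of_real \<rho> ^ k) * (((1/2) gchoose (n - k)) * (-1) ^ (n - k))"
        by simp
    qed
    have "\<sigma> * (?x / of_real (wt n)) = \<sigma> * fps_nth (G * B) n * of_real \<rho> ^ n / of_real (wt n)"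
      unfolding conv[symmetric] by simp
    also have "\<dots> = of_real (fps_nth (1 - fps_X ^ c - 2 * fps_X ^ d * U) n * \<rho> ^ n / wt n)"
      by (simp only: of_real_mult of_real_divide of_real_power nth)
    finally show ?thesis .
  qed
  ultimately have "(\<lambda>n. of_real (fps_nth (1 - fps_X ^ c - 2 * fps_X ^ d * U) n * \<rho> ^ n / wt n))
      \<longlonglongrightarrow> \<sigma> * ((\<Sum>k. fps_nth G k * of_real \<rho> ^ k) * inverse (Gamma (-1/2)))"
    by simp
  moreover have "\<sigma> * ((\<Sum>k. fps_nth G k * of_real \<rho> ^ k) * inverse (Gamma (-1/2))) \<noteq> 0"
  proof -
    have "(-1/2 :: complex) \<notin> \<int>\<^sub>\<le>\<^sub>0"
    proof
      assume "(-1/2 :: complex) \<in> \<int>\<^sub>\<le>\<^sub>0"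
      then obtain n where "(-1/2 :: complex) = of_int n" by (rule nonpos_Ints_cases)
      then have "of_int (2 * n) = (of_int (-1) :: complex)" by (simp add: field_simps)
      then have "2 * n = -1" by (simp only: of_int_eq_iff)
      then show False by presburger
    qed
    then have "Gamma (-1/2 :: complex) \<noteq> 0" by (simp add: Gamma_eq_zero_iff)
    then show ?thesis using \<sigma> G_rho by (simp add: eval_fps_def)
  qed
  ultimately show ?thesis using that by blast
qed

text \<open>The coefficients of \<open>U\<close> are, up to a shift, \<open>-1/2\<close> times those of \<open>S\<close>. Being nonnegative, they fix the sign
  of the nonzero limit.\<close>

lemma U_asymp:
  obtains C where "C > 0" "(\<lambda>n. fps_nth U n * \<rho> ^ n / wt n) \<longlonglongrightarrow> C"
proof -
  define S where "S = 1 - fps_X ^ c - 2 * fps_X ^ d * U"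
  obtain L :: complex where L0: "L \<noteq> 0"
    and L: "(\<lambda>n. of_real (fps_nth S n * \<rho> ^ n / wt n)) \<longlonglongrightarrow> L"
    unfolding S_def by (rule discr_sqrt_coeff_tendsto)
  have "(\<lambda>n. Im (of_real (fps_nth S n * \<rho> ^ n / wt n))) \<longlonglongrightarrow> Im L"
    using L by (rule tendsto_Im)
  then have "Im L = 0" by (simp add: LIMSEQ_const_iff)
  then have ReL: "Re L \<noteq> 0" using L0 by (simp add: complex_eq_iff)
  have "(\<lambda>n. Re (of_real (fps_nth S n * \<rho> ^ n / wt n))) \<longlonglongrightarrow> Re L"
    using L by (rule tendsto_Re)
  then have "(\<lambda>n. fps_nth S n * \<rho> ^ n / wt n) \<longlonglongrightarrow> Re L" by simp
  then have lim: "(\<lambda>n. fps_nth S (n + d) * \<rho> ^ (n + d) / wt (n + d)) \<longlonglongrightarrow> Re L"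
    by (rule LIMSEQ_ignore_initial_segment)
  have "(\<lambda>n. wt (n + d - d) / wt (n + d)) \<longlonglongrightarrow> 1"
    using LIMSEQ_ignore_initial_segment[OF wt_shift_ratio, of d d] .
  then have ratio: "(\<lambda>n. wt n / wt (n + d)) \<longlonglongrightarrow> 1" by simp
  define C where "C = - Re L / (2 * \<rho> ^ d)"
  have "(\<lambda>n. (- 1 / (2 * \<rho> ^ d)) * ((fps_nth S (n + d) * \<rho> ^ (n + d) / wt (n + d)) / (wt n / wt (n + d))))
      \<longlonglongrightarrow> (- 1 / (2 * \<rho> ^ d)) * (Re L / 1)"
    by (intro tendsto_intros lim ratio) auto
  moreover have "eventually (\<lambda>n. (- 1 / (2 * \<rho> ^ d)) * ((fps_nth S (n + d) * \<rho> ^ (n + d) / wt (n + d)) / (wt n / wt (n + d)))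
      = fps_nth U n * \<rho> ^ n / wt n) sequentially"
    \<comment> \<open>For \<open>n > c\<close> the polynomial part \<open>1 - X\<^sup>c\<close> of \<open>S\<close> no longer contributes.\<close>
    using eventually_gt_at_top[of c]
  proof eventually_elim
    case (elim n)
    have "fps_nth S (n + d) = - 2 * fps_nth U n"
      using elim by (simp add: S_def mult.assoc fps_X_power_mult_nth fps_X_power_nth)
    then show ?case using rho_pos by (simp add: field_simps power_add)
  qed
  ultimately have C: "(\<lambda>n. fps_nth U n * \<rho> ^ n / wt n) \<longlonglongrightarrow> C"
    by (simp add: filterlim_cong C_def)
  moreover have "C \<ge> 0"
    using rho_pos by (intro tendsto_lowerbound[OF C] always_eventually allI divide_nonneg_pos mult_nonneg_nonneg) auto
  moreover have "C \<noteq> 0" using ReL rho_pos by (simp add: C_def)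
  ultimately show ?thesis by (intro that[of C]) auto
qed

end


section \<open>Comparing open terms with all terms\<close>

context term_size_params
begin

text \<open>Multiplying the \<open>n\<close>th coefficient by \<open>\<rho>\<^sup>n\<close> moves the singularity to \<open>1\<close>.\<close>

definition scaled :: "real fps \<Rightarrow> nat \<Rightarrow> real" where
  "scaled f n = fps_nth f n * \<rho> ^ n"

lemma scaled_add: "scaled (f + g) n = scaled f n + scaled g n"
  and scaled_diff: "scaled (f - g) n = scaled f n - scaled g n"
  by (simp_all add: scaled_def algebra_simps)

lemma scaled_fps_X_power_mult:
  "scaled (fps_X ^ k * f) n = (if n < k then 0 else \<rho> ^ k * scaled f (n - k))"
  by (simp add: scaled_def fps_X_power_mult_nth flip: power_add)

lemma scaled_mult: "scaled (f * g) n = (\<Sum>k=0..n. scaled f k * scaled g (n - k))"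
  unfolding scaled_def fps_mult_nth sum_distrib_right
proof (rule sum.cong[OF refl])
  fix k assume "k \<in> {0..n}"
  then have "\<rho> ^ n = \<rho> ^ k * \<rho> ^ (n - k)" by (simp flip: power_add)
  then show "f $ k * g $ (n - k) * \<rho> ^ n = f $ k * \<rho> ^ k * (g $ (n - k) * \<rho> ^ (n - k))"
    by simp
qed

text \<open>Absolute convergence at \<open>\<rho>\<close> is part of the notion: \<open>\<rho>\<close> lies on the boundary of the disc of convergence
  of \<open>U\<close>, so evaluation of products there needs Cauchy products.\<close>

definition value_at_rho :: "real fps \<Rightarrow> real \<Rightarrow> bool" where
  "value_at_rho f x \<longleftrightarrow> summable (\<lambda>n. norm (scaled f n)) \<and> scaled f sums x"

lemma value_add:
  assumes "value_at_rho f x" "value_at_rho g y"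
  shows "value_at_rho (f + g) (x + y)"
proof -
  have "summable (\<lambda>n. norm (scaled f n) + norm (scaled g n))"
    using assms unfolding value_at_rho_def by (intro summable_add) auto
  then have "summable (\<lambda>n. norm (scaled (f + g) n))"
    by (rule summable_comparison_test'[where N = 0]) (simp add: scaled_add abs_triangle_ineq)
  moreover have "scaled (f + g) sums (x + y)"
    using assms sums_add[of "scaled f" x "scaled g" y] unfolding value_at_rho_def by (simp add: ext[where f = "scaled (f + g)", OF scaled_add])
  ultimately show ?thesis by (simp add: value_at_rho_def)
qed

lemma value_diff:
  assumes "value_at_rho f x" "value_at_rho g y"
  shows "value_at_rho (f - g) (x - y)"
proof -
  have "summable (\<lambda>n. norm (scaled f n) + norm (scaled g n))"
    using assms unfolding value_at_rho_def by (intro summable_add) auto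
  then have "summable (\<lambda>n. norm (scaled (f - g) n))"
    by (rule summable_comparison_test'[where N = 0]) (simp add: scaled_diff abs_triangle_ineq4)
  moreover have "scaled (f - g) sums (x - y)"
    using assms sums_diff[of "scaled f" x "scaled g" y] unfolding value_at_rho_def by (simp add: ext[where f = "scaled (f - g)", OF scaled_diff])
  ultimately show ?thesis by (simp add: value_at_rho_def)
qed

lemma value_mult:
  assumes "value_at_rho f x" "value_at_rho g y"
  shows "value_at_rho (f * g) (x * y)"
proof -
  have f: "summable (\<lambda>n. norm (scaled f n))" "suminf (scaled f) = x"
    and g: "summable (\<lambda>n. norm (scaled g n))" "suminf (scaled g) = y"
    using assms by (auto simp: value_at_rho_def sums_iff)
  have "(\<lambda>n. \<Sum>k\<le>n. scaled f k * scaled g (n - k)) sums (x * y)"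
    using Cauchy_product_sums[OF f(1) g(1)] f g by simp
  moreover have "summable (\<lambda>n. norm (\<Sum>k\<le>n. scaled f k * scaled g (n - k)))"
  proof (rule summable_comparison_test', rule summable_Cauchy_product)
    show "summable (\<lambda>n. norm (norm (scaled f n)))" "summable (\<lambda>n. norm (norm (scaled g n)))"
      using f g by simp_all
    show "norm (norm (\<Sum>k\<le>n. scaled f k * scaled g (n - k))) \<le>
        (\<Sum>k\<le>n. norm (scaled f k) * norm (scaled g (n - k)))" for n
      using sum_abs[of "\<lambda>k. scaled f k * scaled g (n - k)" "{..n}"] by (simp add: abs_mult)
  qed
  ultimately show ?thesis by (simp add: value_at_rho_def ext[where f = "scaled (f * g)", OF scaled_mult] atLeast0AtMost)
qed

lemma value_const: "value_at_rho (fps_const x) x"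
proof -
  have "scaled (fps_const x) = (\<lambda>n. if n = 0 then x else 0)"
    by (rule ext) (simp add: scaled_def)
  then show ?thesis
    using sums_single[of 0 "\<lambda>_. x"] sums_single[of 0 "\<lambda>_. \<bar>x\<bar>"]
    by (simp add: value_at_rho_def if_distrib[of abs] sums_summable cong: if_cong)
qed

lemma value_one: "value_at_rho 1 1"
  and value_numeral: "value_at_rho (numeral k) (numeral k)"
  using value_const[of 1] value_const[of "numeral k"] by (simp_all flip: numeral_fps_const)

lemma value_fps_X: "value_at_rho fps_X \<rho>"
proof -
  have "scaled fps_X = (\<lambda>n. if n = 1 then \<rho> else 0)"
    by (rule ext) (simp add: scaled_def fps_X_def)
  then show ?thesis
    using sums_single[of 1 "\<lambda>_. \<rho>"] sums_single[of 1 "\<lambda>_. \<bar>\<rho>\<bar>"]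
    by (simp add: value_at_rho_def if_distrib[of abs] sums_summable cong: if_cong)
qed

lemma value_power: "value_at_rho f x \<Longrightarrow> value_at_rho (f ^ n) (x ^ n)"
  by (induction n) (auto intro: value_one value_mult)

lemmas value_intros = value_add value_diff value_mult value_one value_numeral value_fps_X value_power

lemma value_unique: "value_at_rho f x \<Longrightarrow> value_at_rho f y \<Longrightarrow> x = y"
  by (auto simp: value_at_rho_def intro: sums_unique2)

abbreviation (input) L :: "nat \<Rightarrow> real fps" where
  "L \<equiv> open_term_gf a b c d"

lemma L_eq: "L m = index_gf a b {..<m} + fps_X ^ c * L (Suc m) + fps_X ^ d * (L m)\<^sup>2"
  unfolding open_term_gf_eq by (rule term_gf_decomp[OF size_pos open_terms_decomp])

lemma L_nonneg: "fps_nth (L m) n \<ge> 0"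
  by (simp add: open_term_gf_eq)

lemma L_le_U: "fps_nth (L m) n \<le> fps_nth U n"
  unfolding open_term_gf_eq by (rule term_gf_mono[OF size_pos]) simp

lemma scaled_L_nonneg: "scaled (L m) n \<ge> 0" and scaled_U_nonneg: "scaled U n \<ge> 0"
  using rho_pos L_nonneg by (simp_all add: scaled_def)

lemma scaled_L_le_U: "scaled (L m) n \<le> scaled U n"
  unfolding scaled_def using rho_pos L_le_U by (intro mult_right_mono) auto

lemma scaled_U_bound: obtains B where "B \<ge> 0" "\<And>n. scaled U n \<le> B * wt n"
proof -
  obtain C where lim: "(\<lambda>n. scaled U n / wt n) \<longlonglongrightarrow> C"
    unfolding scaled_def by (rule U_asymp)
  obtain B where B: "\<And>n. norm (scaled U n / wt n) \<le> B"
    using convergent_imp_Bseq[OF convergentI[OF lim]] unfolding Bseq_def by blast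
  have "scaled U n \<le> B * wt n" for n
    using B[of n] by (simp add: abs_divide divide_le_eq abs_le_iff)
  moreover have "B \<ge> 0" using B[of 0] norm_ge_zero by (rule order_trans[rotated])
  ultimately show ?thesis using that by blast
qed

lemma summable_scaled_U: "summable (scaled U)" and summable_scaled_L: "summable (scaled (L m))"
proof -
  obtain B where B: "B \<ge> 0" "\<And>n. scaled U n \<le> B * wt n" by (rule scaled_U_bound) auto
  show U: "summable (scaled U)"
    by (rule summable_comparison_test'[OF summable_mult[OF summable_wt, of B]])
       (use B scaled_U_nonneg in auto)
  show "summable (scaled (L m))"
    by (rule summable_comparison_test'[OF U]) (use scaled_L_le_U scaled_L_nonneg in auto)
qed

lemma value_U: "value_at_rho U (suminf (scaled U))"
  using summable_scaled_U scaled_U_nonneg by (simp add: value_at_rho_def summable_sums)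

text \<open>At \<open>\<rho>\<close> the discriminant vanishes, so the quadratic equation for \<open>U\<close> has a double root there.\<close>

lemma U_at_rho: "2 * \<rho> ^ d * suminf (scaled U) = 1 - \<rho> ^ c"
proof -
  let ?u = "suminf (scaled U)"
  have "value_at_rho ((1 - fps_X ^ c - 2 * fps_X ^ d * U)\<^sup>2 * (1 - fps_X ^ b))
      ((1 - \<rho> ^ c - 2 * \<rho> ^ d * ?u)\<^sup>2 * (1 - \<rho> ^ b))"
    by (intro value_intros value_U)
  moreover have "value_at_rho ((1 - fps_X ^ b) * (1 - fps_X ^ c)\<^sup>2 - 4 * fps_X ^ (a + d))
      ((1 - \<rho> ^ b) * (1 - \<rho> ^ c)\<^sup>2 - 4 * \<rho> ^ (a + d))"
    by (intro value_intros)
  ultimately have "(1 - \<rho> ^ c - 2 * \<rho> ^ d * ?u)\<^sup>2 * (1 - \<rho> ^ b) = 0"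
    unfolding U_discr rho_root by (rule value_unique)
  then show ?thesis
    using rho_power_less_1[OF b_pos] by simp
qed

lemma rho_power_le_wt: obtains B where "B \<ge> 0" "\<And>n. \<rho> ^ n \<le> B * wt n"
proof -
  have lim: "(\<lambda>n. \<rho> ^ n / wt n) \<longlonglongrightarrow> 0"
    unfolding wt_def of_nat_Suc using rho_pos rho_less_1 by real_asymp
  obtain B where B: "\<And>n. norm (\<rho> ^ n / wt n) \<le> B"
    using convergent_imp_Bseq[OF convergentI[OF lim]] unfolding Bseq_def by blast
  have "\<rho> ^ n \<le> B * wt n" for n
    using B[of n] rho_pos by (simp add: abs_divide divide_le_eq abs_le_iff)
  moreover have "B \<ge> 0" using B[of 0] norm_ge_zero by (rule order_trans[rotated])
  ultimately show ?thesis using that by blast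
qed

text \<open>A term that is not \<open>m\<close>-open contains a path from the root to an occurrence of an index that is too large.
  Each step of the path enters one side of an application, leaving an arbitrary term on the other side
  (weight \<open>2 X\<^sup>d U\<close>), or passes an abstraction. The abstraction costs \<open>X\<^sup>c\<close> and in addition raises the least
  such index by one, which costs another \<open>X\<^sup>b\<close>. The factor \<open>X\<^bsup>bm\<^esup>\<close> for the openness at the root is
  kept outside.\<close>

definition deep_step :: "real fps" where
  "deep_step = 2 * fps_X ^ d * U + fps_X ^ (b + c)"

definition deep_gf :: "real fps" where
  "deep_gf = index_gf a b UNIV * inverse (1 - deep_step)"

lemma U_shift_0: "fps_nth (fps_X ^ d * U) 0 = 0"
proof (cases "d = 0")
  case True
  have nz: "term_size a b c d M \<noteq> 0" for M
    using size_pos True by (induction M) (auto simp: index_size_eq)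
  have "fps_nth U 0 = 0" by (simp add: term_gf_def nz)
  then show ?thesis by simp
qed simp

lemma deep_step_0: "fps_nth deep_step 0 = 0"
proof -
  have "fps_nth deep_step 0 = 2 * fps_nth (fps_X ^ d * U) 0 + fps_nth (fps_X ^ (b + c)) 0"
    by (simp add: deep_step_def mult.assoc)
  also have "\<dots> = 0"
    using b_pos by (simp only: U_shift_0) simp
  finally show ?thesis .
qed

lemma deep_step_nonneg: "fps_nth deep_step n \<ge> 0"
  by (simp add: deep_step_def mult.assoc fps_X_power_mult_nth)

lemma deep_gf_eq: "deep_gf = index_gf a b UNIV + deep_step * deep_gf"
proof -
  have "fps_nth (1 - deep_step) 0 \<noteq> 0" by (simp add: deep_step_0)
  then have "(1 - deep_step) * inverse (1 - deep_step) = 1"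
    by (metis inverse_mult_eq_1 mult.commute)
  then have "(1 - deep_step) * deep_gf = index_gf a b UNIV"
    by (simp add: deep_gf_def mult.left_commute[of "1 - deep_step"])
  then show ?thesis by (simp add: algebra_simps)
qed

lemma deep_gf_nonneg: "fps_nth deep_gf n \<ge> 0"
proof (induction n rule: less_induct)
  case (less n)
  have "fps_nth deep_step k * fps_nth deep_gf (n - k) \<ge> 0" if "k \<le> n" for k
  proof (cases "k = 0")
    case False
    then show ?thesis using less[of "n - k"] that deep_step_nonneg by simp
  qed (simp add: deep_step_0)
  then have "fps_nth (deep_step * deep_gf) n \<ge> 0"
    unfolding fps_mult_nth by (intro sum_nonneg) auto
  then show ?case
    by (subst deep_gf_eq) simp
qed

text \<open>The path step is subcritical: \<open>2 \<rho>\<^sup>d U(\<rho>) + \<rho>\<^bsup>b+c\<^esup> = 1 - \<rho>\<^sup>c + \<rho>\<^bsup>b+c\<^esup> < 1\<close>.\<close>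

lemma deep_gf_bound: obtains D where "D \<ge> 0" "\<And>n. scaled deep_gf n \<le> D * wt n"
proof -
  obtain B1 where B1: "B1 \<ge> 0" "\<And>n. scaled U n \<le> B1 * wt n" by (rule scaled_U_bound) auto
  obtain B2 where B2: "B2 \<ge> 0" "\<And>n. \<rho> ^ n \<le> B2 * wt n" by (rule rho_power_le_wt) auto
  define B where "B = 2 * \<rho> ^ d * B1 * (real d + 1) powr (3/2) + B2"
  have nonneg: "f = deep_step \<or> f = index_gf a b UNIV \<or> f = deep_gf \<Longrightarrow> scaled f n \<ge> 0" for f n
    using rho_pos deep_step_nonneg deep_gf_nonneg by (auto simp: scaled_def)
  have "\<exists>D\<ge>0. \<forall>n. scaled deep_gf n \<le> D * wt n"
  proof (rule renewal_bound)
    show "scaled deep_gf n = scaled (index_gf a b UNIV) n +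
        (\<Sum>k=0..n. scaled deep_step k * scaled deep_gf (n - k))" for n
      by (subst deep_gf_eq) (simp only: scaled_add scaled_mult)
    show "scaled deep_step 0 = 0" by (simp add: scaled_def deep_step_0)
    have "scaled (index_gf a b UNIV) n \<le> \<rho> ^ n" for n
      using index_gf_le_1[OF b_pos, of a UNIV n] rho_pos by (simp add: scaled_def)
    moreover have "B2 * wt n \<le> B * wt n" for n
      using B1 rho_pos by (intro mult_right_mono) (auto simp: B_def)
    ultimately show "scaled (index_gf a b UNIV) n \<le> B * wt n" for n
      using B2(2) by (meson order_trans)
    show "scaled deep_step n \<le> B * wt n" for n
    proof -
      have "scaled (fps_X ^ d * U) n \<le> \<rho> ^ d * (B1 * ((real d + 1) powr (3/2) * wt n))"
      proof (cases "n < d")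
        case True
        then show ?thesis using rho_pos B1 by (simp add: scaled_fps_X_power_mult)
      next
        case False
        have "scaled U (n - d) \<le> B1 * wt (n - d)" by (rule B1)
        also have "\<dots> \<le> B1 * ((real d + 1) powr (3/2) * wt n)"
          using False B1 by (intro mult_left_mono wt_shift_le) auto
        finally show ?thesis
          using False rho_pos by (simp add: scaled_fps_X_power_mult)
      qed
      moreover have "scaled (fps_X ^ (b + c)) n \<le> B2 * wt n"
      proof -
        have "scaled (fps_X ^ (b + c)) n \<le> \<rho> ^ n"
          using rho_pos by (simp add: scaled_def fps_X_power_nth)
        then show ?thesis using B2(2) order_trans by blast
      qed
      moreover have "scaled deep_step n = 2 * scaled (fps_X ^ d * U) n + scaled (fps_X ^ (b + c)) n"
        by (simp add: deep_step_def scaled_def mult.assoc algebra_simps)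
      ultimately show ?thesis by (simp add: B_def algebra_simps)
    qed
    have "value_at_rho deep_step (2 * \<rho> ^ d * suminf (scaled U) + \<rho> ^ (b + c))"
      unfolding deep_step_def by (intro value_intros value_U)
    then have "suminf (scaled deep_step) = 2 * \<rho> ^ d * suminf (scaled U) + \<rho> ^ (b + c)"
      by (simp add: value_at_rho_def sums_iff)
    also have "\<dots> = 1 - \<rho> ^ c * (1 - \<rho> ^ b)"
      using U_at_rho by (simp add: power_add algebra_simps)
    also have "\<dots> < 1"
      using rho_pos rho_power_less_1[OF b_pos] by simp
    finally show "suminf (scaled deep_step) < 1" .
  qed (use nonneg in auto)
  then show ?thesis using that by blast
qed

lemma index_gf_split:
  "index_gf a b UNIV = index_gf a b {..<m} + fps_X ^ (b * m) * index_gf a b UNIV"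
proof -
  have "{..<m} \<union> {m..} = (UNIV :: nat set)" by auto
  moreover have "{..<m} \<inter> {m..} = {}" by auto
  ultimately have "index_gf a b UNIV = index_gf a b {..<m} + index_gf a b {m..}"
    using index_gf_Un[OF b_pos, of "{..<m}" "{m..}" a] by simp
  then show ?thesis by (simp only: index_gf_atLeast[OF b_pos])
qed

lemma non_open_eq:
  "U - L m = fps_X ^ (b * m) * index_gf a b UNIV + fps_X ^ c * (U - L (Suc m)) +
     fps_X ^ d * (U + L m) * (U - L m)"
proof -
  have "U - L m = (index_gf a b UNIV + fps_X ^ c * U + fps_X ^ d * U\<^sup>2) -
      (index_gf a b {..<m} + fps_X ^ c * L (Suc m) + fps_X ^ d * (L m)\<^sup>2)"
    using U_eq L_eq[of m] by simp
  also have "\<dots> = (index_gf a b UNIV - index_gf a b {..<m}) + fps_X ^ c * (U - L (Suc m)) +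
     fps_X ^ d * (U + L m) * (U - L m)"
    by (simp add: algebra_simps power2_eq_square)
  also have "index_gf a b UNIV - index_gf a b {..<m} = fps_X ^ (b * m) * index_gf a b UNIV"
    using index_gf_split[of m] by (simp add: algebra_simps)
  finally show ?thesis .
qed

text \<open>Both sides satisfy a recursion of the same shape, with \<open>U + L m \<le> 2 U\<close>. Each recursive call goes to a
  strictly smaller coefficient because \<open>c \<ge> 1\<close> and \<open>X\<^sup>d U\<close> has no constant term; \<open>m\<close> must be arbitrary since
  abstraction increases it.\<close>

lemma non_open_le: "fps_nth (U - L m) n \<le> fps_nth (fps_X ^ (b * m) * deep_gf) n"
proof (induction n arbitrary: m rule: less_induct)
  case (less n)
  define V where "V m = fps_X ^ (b * m) * deep_gf" for m
  define K where "K m = U - L m" for m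
  have V_nonneg: "fps_nth (V m) k \<ge> 0" for m k
    by (simp add: V_def fps_X_power_mult_nth deep_gf_nonneg)
  have V_eq: "V m = fps_X ^ (b * m) * index_gf a b UNIV + fps_X ^ c * V (Suc m) + (2 * (fps_X ^ d * U)) * V m"
  proof -
    have "V m = fps_X ^ (b * m) * (index_gf a b UNIV + deep_step * deep_gf)"
      unfolding V_def by (subst deep_gf_eq) (rule refl)
    then show ?thesis
      by (simp add: deep_step_def V_def power_add algebra_simps)
  qed
  have K_eq: "K m = fps_X ^ (b * m) * index_gf a b UNIV + fps_X ^ c * K (Suc m) +
      (fps_X ^ d * (U + L m)) * K m"
    unfolding K_def by (rule non_open_eq)
  have 1: "fps_nth (fps_X ^ c * K (Suc m)) n \<le> fps_nth (fps_X ^ c * V (Suc m)) n"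
    using less[of "n - c" "Suc m"] c_pos by (simp add: fps_X_power_mult_nth K_def V_def)
  have 2: "fps_nth ((fps_X ^ d * (U + L m)) * K m) n \<le> fps_nth ((2 * (fps_X ^ d * U)) * V m) n"
    unfolding fps_mult_nth[of _ "K m"] fps_mult_nth[of _ "V m"]
  proof (rule sum_mono)
    fix k assume k: "k \<in> {0..n}"
    have t: "0 \<le> fps_nth (fps_X ^ d * (U + L m)) k"
      "fps_nth (fps_X ^ d * (U + L m)) k \<le> fps_nth (2 * (fps_X ^ d * U)) k"
      using L_nonneg L_le_U by (simp_all add: fps_X_power_mult_nth)
    show "fps_nth (fps_X ^ d * (U + L m)) k * fps_nth (K m) (n - k) \<le>
        fps_nth (2 * (fps_X ^ d * U)) k * fps_nth (V m) (n - k)"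
    proof (cases "k = 0")
      case True
      have U0: "fps_nth (2 * (fps_X ^ d * U)) 0 = 0"
        using U_shift_0 by simp
      have UL0: "fps_nth (fps_X ^ d * (U + L m)) 0 = 0"
        using t unfolding True U0 by (rule antisym[rotated])
      show ?thesis unfolding True U0 UL0 by simp
    next
      case False
      then have "fps_nth (K m) (n - k) \<le> fps_nth (V m) (n - k)"
        using less[of "n - k" m] k by (simp add: K_def V_def)
      then have "fps_nth (fps_X ^ d * (U + L m)) k * fps_nth (K m) (n - k) \<le>
          fps_nth (fps_X ^ d * (U + L m)) k * fps_nth (V m) (n - k)"
        using t by (intro mult_left_mono)
      also have "\<dots> \<le> fps_nth (2 * (fps_X ^ d * U)) k * fps_nth (V m) (n - k)"
        using t V_nonneg by (intro mult_right_mono)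
      finally show ?thesis .
    qed
  qed
  have "fps_nth (K m) n \<le> fps_nth (V m) n"
    using 1 2 by (subst K_eq, subst V_eq) (simp only: fps_add_nth)
  then show ?case by (simp add: K_def V_def)
qed

end

section \<open>Descending from large to small openness\<close>

context term_size_params
begin

lemma near_L_large:
  obtains C D where "C > 0" "D \<ge> 0" "\<And>M. near (scaled (L M)) C (\<rho> ^ (b * M) * D)"
proof -
  obtain C where C: "C > 0" "(\<lambda>n. fps_nth U n * \<rho> ^ n / wt n) \<longlonglongrightarrow> C" by (rule U_asymp)
  obtain D where D: "D \<ge> 0" "\<And>n. scaled deep_gf n \<le> D * wt n" by (rule deep_gf_bound) auto
  have "near (scaled (L M)) C (\<rho> ^ (b * M) * D)" for M
  proof -
    have V_nonneg: "scaled (fps_X ^ (b * M) * deep_gf) n \<ge> 0" for n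
      using rho_pos deep_gf_nonneg by (simp add: scaled_def fps_X_power_mult_nth)
    have "near (scaled deep_gf) 0 (D + \<bar>0\<bar>)"
      using D deep_gf_nonneg rho_pos by (intro near_of_bound) (simp add: scaled_def)
    then have "near (\<lambda>n. \<rho> ^ (b * M) * (if n < b * M then 0 else scaled deep_gf (n - b * M)))
        (\<rho> ^ (b * M) * 0) (\<rho> ^ (b * M) * D)"
      using rho_pos by (intro near_cmult near_shift) auto
    moreover have "\<bar>- scaled (U - L M) n\<bar> \<le>
        \<bar>\<rho> ^ (b * M) * (if n < b * M then 0 else scaled deep_gf (n - b * M))\<bar>" for n
    proof -
      have "0 \<le> scaled (U - L M) n"
        using scaled_L_le_U by (simp add: scaled_diff)
      moreover have "scaled (U - L M) n \<le> scaled (fps_X ^ (b * M) * deep_gf) n"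
        unfolding scaled_def using non_open_le rho_pos by (intro mult_right_mono) auto
      moreover have "\<rho> ^ (b * M) * (if n < b * M then 0 else scaled deep_gf (n - b * M)) =
          scaled (fps_X ^ (b * M) * deep_gf) n"
        by (simp add: scaled_fps_X_power_mult)
      ultimately show ?thesis by simp
    qed
    ultimately have "near (\<lambda>n. - scaled (U - L M) n) 0 (\<rho> ^ (b * M) * D)"
      using near_0_mono by simp
    moreover have "near (scaled U) C 0"
      using C unfolding scaled_def by (intro near_of_limit)
    ultimately have "near (\<lambda>n. scaled U n + - scaled (U - L M) n) (C + 0) (0 + \<rho> ^ (b * M) * D)"
      by (intro near_add)
    then show ?thesis by (simp add: scaled_diff)
  qed
  with C D that show ?thesis by blast
qed

definition descent_factor :: "nat \<Rightarrow> real" where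
  "descent_factor m = \<rho> ^ c / (1 - 2 * \<rho> ^ d * suminf (scaled (L m)))"

text \<open>The upper bound comes from \<open>L m \<le> U\<close> and the value of \<open>U\<close> at \<open>\<rho>\<close>.\<close>

lemma descent_factor_bounds:
  "2 * \<rho> ^ d * suminf (scaled (L m)) \<ge> 0" "2 * \<rho> ^ d * suminf (scaled (L m)) < 1"
  "descent_factor m > 0" "descent_factor m \<le> 1"
proof -
  have "suminf (scaled (L m)) \<le> suminf (scaled U)"
    by (intro suminf_le scaled_L_le_U summable_scaled_L summable_scaled_U)
  then have "2 * \<rho> ^ d * suminf (scaled (L m)) \<le> 2 * \<rho> ^ d * suminf (scaled U)"
    using rho_pos by (intro mult_left_mono) auto
  then have le: "2 * \<rho> ^ d * suminf (scaled (L m)) \<le> 1 - \<rho> ^ c"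
    by (simp only: U_at_rho)
  show "2 * \<rho> ^ d * suminf (scaled (L m)) \<ge> 0"
    using rho_pos by (intro mult_nonneg_nonneg suminf_nonneg summable_scaled_L scaled_L_nonneg) auto
  have "\<rho> ^ c > 0" using rho_pos by simp
  then show "2 * \<rho> ^ d * suminf (scaled (L m)) < 1" using le by linarith
  then show "descent_factor m > 0" "descent_factor m \<le> 1"
    using le \<open>\<rho> ^ c > 0\<close> by (simp_all add: descent_factor_def)
qed

text \<open>Relative to \<open>wt\<close>, the equation for \<open>L m\<close> reads \<open>l' = \<rho>\<^sup>c l + \<theta> l'\<close> for the limits and
  \<open>x \<mapsto> \<rho>\<^sup>c e + \<theta> x\<close> for the errors, with \<open>\<theta> = 2 \<rho>\<^sup>d L m (\<rho>) < 1\<close>.\<close>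

lemma near_L_descent:
  assumes near: "near (scaled (L (Suc m))) l e"
  shows "near (scaled (L m)) (descent_factor m * l) (descent_factor m * e)"
proof -
  define \<theta> where "\<theta> = 2 * \<rho> ^ d * suminf (scaled (L m))"
  have \<theta>: "0 \<le> \<theta>" "\<theta> < 1" using descent_factor_bounds by (auto simp: \<theta>_def)
  define l' where "l' = descent_factor m * l"
  have l': "\<rho> ^ c * l + \<theta> * l' = l'"
  proof -
    have "descent_factor m * (1 - \<theta>) = \<rho> ^ c"
      unfolding descent_factor_def \<theta>_def[symmetric] using \<theta> by simp
    then have "\<rho> ^ c * l = descent_factor m * (1 - \<theta>) * l" by simp
    also have "\<dots> = descent_factor m * l - \<theta> * (descent_factor m * l)" by (simp add: algebra_simps)
    finally show ?thesis unfolding l'_def by simp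
  qed
  obtain B where B: "B \<ge> 0" "\<And>n. scaled U n \<le> B * wt n" by (rule scaled_U_bound) auto
  have "near (scaled (L m)) l' (\<rho> ^ c * e / (1 - \<theta>))"
  proof (rule near_contraction[OF _ _ \<theta>])
    show "near (scaled (L m)) l' (B + \<bar>l'\<bar>)"
      using B(2) scaled_L_le_U scaled_L_nonneg by (intro near_of_bound) (simp, meson order_trans)
  next
    fix x assume x: "near (scaled (L m)) l' x"
    \<comment> \<open>Only finitely many indices are below \<open>m\<close>, so their generating function is a polynomial.\<close>
    have index: "near (scaled (index_gf a b {..<m})) 0 0"
      unfolding near_def
    proof (intro allI impI)
      fix e' :: real assume "e' > 0"
      have zero: "scaled (index_gf a b {..<m}) n = 0" if n: "n > a + b * m" for n
      proof -
        have "a + b * k \<noteq> n" if "k < m" for k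
        proof -
          have "b * k \<le> b * m" using that by simp
          then show ?thesis using n by linarith
        qed
        then have "{k \<in> {..<m}. a + b * k = n} = {}" by auto
        then show ?thesis unfolding scaled_def index_gf_def fps_nth_Abs_fps by simp
      qed
      show "\<forall>\<^sub>F n in sequentially. \<bar>scaled (index_gf a b {..<m}) n - 0 * wt n\<bar> \<le> e' * wt n"
        using eventually_gt_at_top[of "a + b * m"] by eventually_elim (use \<open>e' > 0\<close> in \<open>simp add: zero\<close>)
    qed
    have nr: "near (\<lambda>n. scaled (index_gf a b {..<m}) n
        + \<rho> ^ c * (if n < c then 0 else scaled (L (Suc m)) (n - c))
        + \<rho> ^ d * (if n < d then 0 else \<Sum>k=0..n-d. scaled (L m) k * scaled (L m) (n - d - k)))
      (0 + \<rho> ^ c * l + \<rho> ^ d * (2 * suminf (scaled (L m)) * l'))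
      (0 + \<rho> ^ c * e + \<rho> ^ d * (2 * suminf (scaled (L m)) * x))"
      using rho_pos
      by (intro near_add index near_cmult near_shift[where f = "\<lambda>n. \<Sum>k=0..n. scaled (L m) k * scaled (L m) (n - k)"]
          near_shift near near_square summable_scaled_L scaled_L_nonneg x) auto
    have eq: "scaled (L m) n = scaled (index_gf a b {..<m}) n
        + \<rho> ^ c * (if n < c then 0 else scaled (L (Suc m)) (n - c))
        + \<rho> ^ d * (if n < d then 0 else \<Sum>k=0..n-d. scaled (L m) k * scaled (L m) (n - d - k))" for n
    proof -
      have "scaled (L m) n = scaled (index_gf a b {..<m} + fps_X ^ c * L (Suc m) + fps_X ^ d * (L m * L m)) n"
        using L_eq[of m] by (simp add: power2_eq_square)
      then show ?thesis
        by (simp add: scaled_add scaled_fps_X_power_mult scaled_mult[of "L m"])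
    qed
    have c1: "0 + \<rho> ^ c * l + \<rho> ^ d * (2 * suminf (scaled (L m)) * l') = l'"
      using l' by (simp add: \<theta>_def mult_ac)
    have c2: "0 + \<rho> ^ c * e + \<rho> ^ d * (2 * suminf (scaled (L m)) * x) = \<rho> ^ c * e + \<theta> * x"
      by (simp add: \<theta>_def mult_ac)
    show "near (scaled (L m)) l' (\<rho> ^ c * e + \<theta> * x)"
      using nr unfolding eq[symmetric] c1 c2 .
  qed
  moreover have "\<rho> ^ c * e / (1 - \<theta>) = descent_factor m * e"
    by (simp add: descent_factor_def \<theta>_def)
  ultimately show ?thesis by (simp add: l'_def)
qed

text \<open>The approximations obtained from starting points \<open>M\<close> have errors tending to \<open>0\<close>, which gives
  convergence. A single \<open>M\<close> with relative error below \<open>1/2\<close> gives positivity.\<close>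

lemma L_asymp:
  obtains C where "C > 0" "(\<lambda>n. scaled (L m) n / wt n) \<longlonglongrightarrow> C"
proof -
  obtain C D where C: "C > 0" and D: "D \<ge> 0"
    and large: "\<And>M. near (scaled (L M)) C (\<rho> ^ (b * M) * D)"
    using near_L_large by blast
  have descent: "\<exists>R>0. R \<le> 1 \<and> near (scaled (L m)) (R * C) (R * (\<rho> ^ (b * M) * D))" if "m \<le> M" for M
    using that
  proof (induction rule: inc_induct)
    case base
    then show ?case using large[of M] by (intro exI[of _ 1]) auto
  next
    case (step k)
    then obtain R where R: "R > 0" "R \<le> 1" "near (scaled (L (Suc k))) (R * C) (R * (\<rho> ^ (b * M) * D))"
      by blast
    have "descent_factor k * R \<le> 1"
      using R descent_factor_bounds[of k] by (intro mult_le_one) auto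
    moreover have "descent_factor k * R > 0"
      using R descent_factor_bounds[of k] by simp
    moreover have "near (scaled (L k)) (descent_factor k * R * C) (descent_factor k * R * (\<rho> ^ (b * M) * D))"
      using near_L_descent[OF R(3)] by (simp add: mult.assoc)
    ultimately show ?case by blast
  qed
  have small: "\<exists>M\<ge>m. \<rho> ^ (b * M) * D < \<delta>" if "\<delta> > 0" for \<delta>
  proof -
    have "(\<lambda>M. (\<rho> ^ b) ^ M * D) \<longlonglongrightarrow> 0 * D"
      using rho_pos rho_power_less_1[OF b_pos] by (intro tendsto_intros LIMSEQ_power_zero) auto
    then have "\<forall>\<^sub>F M in sequentially. (\<rho> ^ b) ^ M * D < \<delta>"
      using that by (intro order_tendstoD) auto
    then have "\<forall>\<^sub>F M in sequentially. M \<ge> m \<and> \<rho> ^ (b * M) * D < \<delta>"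
      using eventually_ge_at_top[of m] by eventually_elim (simp add: power_mult)
    then show ?thesis by (auto simp: eventually_at_top_linorder)
  qed
  have "convergent (\<lambda>n. scaled (L m) n / wt n)"
  proof (rule near_imp_convergent)
    fix \<delta> :: real assume "\<delta> > 0"
    then obtain M where M: "M \<ge> m" "\<rho> ^ (b * M) * D < \<delta>" using small by blast
    obtain R where R: "R > 0" "R \<le> 1" "near (scaled (L m)) (R * C) (R * (\<rho> ^ (b * M) * D))"
      using descent[OF M(1)] by blast
    have "R * (\<rho> ^ (b * M) * D) \<le> \<rho> ^ (b * M) * D"
      using R D rho_pos by (intro mult_left_le_one_le) auto
    then have "R * (\<rho> ^ (b * M) * D) < \<delta>" using M(2) by simp
    then show "\<exists>l e. e < \<delta> \<and> near (scaled (L m)) l e" using R(3) by blast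
  qed
  then obtain l where l: "(\<lambda>n. scaled (L m) n / wt n) \<longlonglongrightarrow> l" by (auto simp: convergent_def)
  obtain M where M: "M \<ge> m" "\<rho> ^ (b * M) * D < C / 2" using small[of "C / 2"] C by auto
  obtain R where R: "R > 0" "R \<le> 1" "near (scaled (L m)) (R * C) (R * (\<rho> ^ (b * M) * D))"
    using descent[OF M(1)] by blast
  have "R * (\<rho> ^ (b * M) * D) < R * (C / 2)" using R M by simp
  then have "\<forall>\<^sub>F n in sequentially. \<bar>scaled (L m) n - R * C * wt n\<bar> \<le> R * (C / 2) * wt n"
    using R(3) unfolding near_def by blast
  then have "\<forall>\<^sub>F n in sequentially. scaled (L m) n / wt n \<ge> R * C / 2"
  proof eventually_elim
    case (elim n)
    then have "- (scaled (L m) n - R * C * wt n) \<le> R * (C / 2) * wt n" by (rule abs_le_D2)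
    then have "R * C / 2 * wt n \<le> scaled (L m) n" by (simp add: mult_ac)
    then show ?case by (simp add: le_divide_eq)
  qed
  then have "R * C / 2 \<le> l" by (intro tendsto_lowerbound[OF l]) auto
  moreover have "R * C / 2 > 0" using R C by simp
  ultimately have "l > 0" by linarith
  with l that show ?thesis by blast
qed

end

theorem theorem1:
  fixes a b c d m :: nat and \<rho> :: real
  assumes "a + d \<ge> 1" and "b \<ge> 1" and "c \<ge> 1"
    and "gcd b (gcd c (a + d)) = 1"
    and "\<rho> > 0"
    and "(1 - \<rho> ^ b) * (1 - \<rho> ^ c)\<^sup>2 - 4 * \<rho> ^ (a + d) = 0"
    and "\<And>z::real. z > 0 \<Longrightarrow> (1 - z ^ b) * (1 - z ^ c)\<^sup>2 - 4 * z ^ (a + d) = 0 \<Longrightarrow> \<rho> \<le> z"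
  shows "\<exists>C::real. C > 0 \<and>
    (\<lambda>n::nat. fps_nth (open_term_gf a b c d m) n)
      \<sim>[at_top] (\<lambda>n. C * real n powr (-3/2) * \<rho> powi (- int n))"
proof -
  interpret term_size_params a b c d \<rho>
    by standard (fact assms)+
  obtain C where C: "C > 0" and lim: "(\<lambda>n. scaled (L m) n / wt n) \<longlonglongrightarrow> C"
    by (rule L_asymp)
  have "(\<lambda>n. wt n / real n powr (-3/2)) \<longlonglongrightarrow> 1"
    unfolding wt_def of_nat_Suc by real_asymp
  then have "(\<lambda>n. (scaled (L m) n / wt n) * (wt n / real n powr (-3/2)) / C) \<longlonglongrightarrow> C * 1 / C"
    using C by (intro tendsto_intros lim) auto
  moreover have "(scaled (L m) n / wt n) * (wt n / real n powr (-3/2)) / C =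
      fps_nth (L m) n / (C * real n powr (-3/2) * \<rho> powi (- int n))" for n
    using rho_pos by (simp add: scaled_def power_int_minus field_simps)
  ultimately have "(\<lambda>n. fps_nth (L m) n) \<sim>[at_top] (\<lambda>n. C * real n powr (-3/2) * \<rho> powi (- int n))"
    using C by (intro asymp_equivI') simp
  with C show ?thesis by blast
qed

end
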